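(* Let $0\le a<b<c\le K+1$ be integers and let $\hat m$ be a model size satisfying the stopping rule. Let $(i_1,\ldots,i_K)\in\mathcal A_K$ satisfy the Irrepresentable Check, with $\mathbb P(\hat m\le a,\hat\imath_1=i_1,\ldots,\hat\imath_K=i_K)>0$, and suppose that the null hypothesis $X\beta^0\in H_a$ holds on $\{\hat\imath_1=i_1,\ldots,\hat\imath_K=i_K\}$, i.e. $X\beta^0\in\mathrm{Span}(X_{j_1},\ldots,X_{j_a})$, where $j_k\in[p]$ is the variable encoded by $i_k$. Then, conditionally on $\{\hat m\le a\}\cap\{\hat\imath_1=i_1,\ldots,\hat\imath_K=i_K\}$, $$\hat\alpha_{abc}:=1-\frac{\mathbb F_{abc}(\lambda_b)}{\mathbb F_{abc}(\lambda_a)}$$ is uniformly distributed on $(0,1)$.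
   Context: Notation: $[m]=\{1,\ldots,m\}$. Let $X\in\mathbb R^{n\times p}$ be a fixed matrix of rank $r>0$ with columns $X_1,\ldots,X_p$, and $Y=X\beta^0+\eta$ with $\beta^0\in\mathbb R^p$, $\eta\sim\mathcal N_n(0,\sigma^2\mathrm{Id}_n)$, $\sigma>0$ known. $K$ is a fixed integer with $1\le K<\min(n,r)$. Signed indices: $i\in[2p]$ encodes a variable $j\in[p]$ and a sign $s\in\{\pm1\}$ via $i=j+p\frac{1-s}{2}$. Put $\bar Z=X^\top Y$, $Z=(\bar Z,-\bar Z)\in\mathbb R^{2p}$, with covariance $\sigma^2R$, $R=\begin{pmatrix}X^\top X&-X^\top X\\-X^\top X&X^\top X\end{pmatrix}$. For $i_1,\ldots,i_k\in[2p]$ let $M_{i_1,\ldots,i_k}$ be the submatrix of $R$ with rows and columns indexed by $i_1,\ldots,i_k$, and for $j\in[2p]$ let $\theta_j(i_1,\ldots,i_k)=(R_{j,i_1}\cdots R_{j,i_k})M_{i_1,\ldots,i_k}^{-1}(1,\ldots,1)^\top$ and $\Pi_{i_1,\ldots,i_k}(Z_j)=(R_{j,i_1}\cdots R_{j,i_k})M_{i_1,\ldots,i_k}^{-1}(Z_{i_1},\ldots,Z_{i_k})^\top$ (both are $0$ when $k=0$). LARS knots $\lambda_1\ge\lambda_2\ge\cdots$ and signed variables $\hat\imath_1,\hat\imath_2,\ldots\in[2p]$: for $k\ge1$, $\lambda_k=\max_{j:\,\theta_j(\hat\imath_1,\ldots,\hat\imath_{k-1})<1}\frac{Z_j-\Pi_{\hat\imath_1,\ldots,\hat\imath_{k-1}}(Z_j)}{1-\theta_j(\hat\imath_1,\ldots,\hat\imath_{k-1})}$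 and $\hat\imath_k$ is the corresponding argmax. $\bar\imath_k\in[p]$ denotes the variable encoded by $\hat\imath_k$, $H_0=\{0\}$, $H_a=\mathrm{Span}(X_{\bar\imath_1},\ldots,X_{\bar\imath_a})$. By convention $\lambda_0=\infty$. $\mathcal A_K$ is the set of $(i_1,\ldots,i_K)\in[2p]^K$ whose underlying variables are pairwise different. $(i_1,\ldots,i_K)\in\mathcal A_K$ satisfies the Irrepresentable Check if for all $k\in[K]$ the matrix $M_{i_1,\ldots,i_k}$ is invertible and $\theta_j(i_1,\ldots,i_k)<1$ for all $j\in[2p]\setminus\{i_1,\ldots,i_k\}$. Stopping rule: $\hat m$ is a random variable with values in $\{0,1,\ldots,K-1\}$ such that, for all $0\le a\le K-1$, $\mathbf 1_{\{\hat m\le a\}}$ is a measurable function of $(\lambda_1,\ldots,\lambda_a,\hat\imath_1,\ldots,\hat\imath_K)$. Scales: $\rho_1=\sqrt{R_{\hat\imath_1,\hat\imath_1}}$ and, for $2\le\ell\le K+1$, $\rho_\ell=\frac{\sqrt{R_{\hat\imath_\ell,\hat\imath_\ell}-(R_{\hat\imath_\ell,\hat\imath_1}\cdots R_{\hat\imath_\ell,\hat\imath_{\ell-1}})M^{-1}_{\hat\imath_1,\ldots,\hat\imath_{\ell-1}}(R_{\hat\imath_\ell,\hat\imath_1},\ldots,R_{\hat\imath_\ell,\hat\imath_{\ell-1}})^\top}}{1-\theta_{\hat\imath_\ell}(\hat\imath_1,\ldots,\hat\imath_{\ell-1})}$. With $\Phi$ the standard normal CDF, let $\Phi_i(x)=\Phi(x/(\sigma\rho_i))$,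 $F_i=\Phi_i(\lambda_i)$, $\mathcal P_{i,j}=\Phi_i\circ\Phi_j^{-1}$ for $i,j\in[K+1]$; by convention $F_0=1$ and $\mathcal P_{i,0}(F_0)=1$. For $0\le a<b$ define $$\mathcal I_{ab}(s,t)=\int_{\mathcal P_{a+1,b}(t)}^{\mathcal P_{a+1,a}(s)}df_{a+1}\int_{\mathcal P_{a+2,b}(t)}^{\mathcal P_{a+2,a+1}(f_{a+1})}df_{a+2}\cdots\int_{\mathcal P_{b-1,b}(t)}^{\mathcal P_{b-1,b-2}(f_{b-2})}df_{b-1},$$ with $\mathcal I_{ab}=1$ if $b=a+1$, and for $0\le a<b<c\le K+1$ $$\mathbb F_{abc}(t)=\mathbf 1_{\{\lambda_c\le t\le\lambda_a\}}\int_{\Phi_b(\lambda_c)}^{\Phi_b(t)}\mathcal I_{ab}(F_a,f_b)\,\mathcal I_{bc}(f_b,F_c)\,df_b.$$ *)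

theory Defs
  imports
    "HOL-Probability.Probability"
    "Jordan_Normal_Form.Gauss_Jordan_Elimination"
begin

(* Jordan_Normal_Form also uses $; here $ always selects components of vectors in real^'n. *)
no_notation Matrix.vec_index (infixl "$" 100)

section \<open>Signed indices and the correlation structure\<close>

text \<open>
  A signed index is an element of \<open>'p + 'p\<close>: the left copy carries the sign $+1$ (the indices
  $1, \dots, p$), the right copy the sign $-1$ (the indices $p+1, \dots, 2p$).
\<close>

definition var_of :: "'p + 'p \<Rightarrow> 'p" where
  "var_of i = (case i of Inl j \<Rightarrow> j | Inr j \<Rightarrow> j)"

definition sign_of :: "'p + 'p \<Rightarrow> real" where
  "sign_of i = (case i of Inl _ \<Rightarrow> 1 | Inr _ \<Rightarrow> - 1)"

definition Z_vec :: "real^'p^'n \<Rightarrow> real^'n \<Rightarrow> 'p + 'p \<Rightarrow> real" where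
  "Z_vec X y i = sign_of i * (Finite_Cartesian_Product.transpose X *v y) $ var_of i"

definition R_mat :: "real^'p^'n \<Rightarrow> 'p + 'p \<Rightarrow> 'p + 'p \<Rightarrow> real" where
  "R_mat X i j =
     sign_of i * sign_of j * (Finite_Cartesian_Product.transpose X ** X) $ var_of i $ var_of j"

text \<open>
  A tuple $(i_1,\dots,i_k)$ is a list \<open>idx\<close> of length $k$, so that $i_l$ is \<open>idx ! (l - 1)\<close>. Since $k$
  varies, the matrices $M_{i_1,\dots,i_k}$ use the matrix type with explicit dimensions.
\<close>

definition M_mat :: "real^'p^'n \<Rightarrow> ('p + 'p) list \<Rightarrow> real Matrix.mat" where
  "M_mat X idx = Matrix.mat (length idx) (length idx) (\<lambda>(k, l). R_mat X (idx ! k) (idx ! l))"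

text \<open>
  \<open>R_regress X idx j w\<close> is $(R_{j,i_1} \cdots R_{j,i_k}) M_{i_1,\dots,i_k}^{-1} (w_{1},\dots,w_{k})^\top$.
  The inverse of a singular matrix is totalized to the zero matrix of the same size.
\<close>

definition mat_inv :: "real Matrix.mat \<Rightarrow> real Matrix.mat" where
  "mat_inv A =
     (case mat_inverse A of Some B \<Rightarrow> B | None \<Rightarrow> 0\<^sub>m (dim_row A) (dim_col A))"

definition R_regress :: "real^'p^'n \<Rightarrow> ('p + 'p) list \<Rightarrow> 'p + 'p \<Rightarrow> real list \<Rightarrow> real" where
  "R_regress X idx j w =
     scalar_prod (vec_of_list (map (R_mat X j) idx))
       (mult_mat_vec (mat_inv (M_mat X idx)) (vec_of_list w))"

definition theta :: "real^'p^'n \<Rightarrow> ('p + 'p) list \<Rightarrow> 'p + 'p \<Rightarrow> real" where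
  "theta X idx j = R_regress X idx j (map (\<lambda>_. 1) idx)"

definition Pi_proj :: "real^'p^'n \<Rightarrow> real^'n \<Rightarrow> ('p + 'p) list \<Rightarrow> 'p + 'p \<Rightarrow> real" where
  "Pi_proj X y idx j = R_regress X idx j (map (Z_vec X y) idx)"

lemma mat_inv_M_mat_carrier: "mat_inv (M_mat X idx) \<in> carrier_mat (length idx) (length idx)"
proof -
  have M: "M_mat X idx \<in> carrier_mat (length idx) (length idx)" by (simp add: M_mat_def)
  then show ?thesis
    using mat_inverse(2)[OF M] by (auto simp: mat_inv_def split: option.split)
qed

lemma theta_Nil: "theta X [] j = 0"
  and Pi_proj_Nil: "Pi_proj X y [] j = 0"
  using mat_inv_M_mat_carrier[of X "[]"]
  by (simp_all add: theta_def Pi_proj_def R_regress_def scalar_prod_def)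


section \<open>The LARS path\<close>

definition lars_ratio :: "real^'p^'n \<Rightarrow> real^'n \<Rightarrow> ('p + 'p) list \<Rightarrow> 'p + 'p \<Rightarrow> real" where
  "lars_ratio X y idx j = (Z_vec X y j - Pi_proj X y idx j) / (1 - theta X idx j)"

text \<open>
  \<open>lars_path X y k\<close> is the list of the first $k$ signed variables entering the path. Among several
  maximizers \<open>arg_max\<close> selects one that depends only on the set of maximizers.
\<close>

primrec lars_path :: "real^'p^'n \<Rightarrow> real^'n \<Rightarrow> nat \<Rightarrow> ('p + 'p) list" where
  "lars_path X y 0 = []"
| "lars_path X y (Suc k) =
     lars_path X y k @
       [arg_max (lars_ratio X y (lars_path X y k)) (\<lambda>j. theta X (lars_path X y k) j < 1)]"

definition lars_index :: "real^'p^'n \<Rightarrow> real^'n \<Rightarrow> nat \<Rightarrow> 'p + 'p" where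
  "lars_index X y k = lars_path X y k ! (k - 1)"

definition lars_knot :: "real^'p^'n \<Rightarrow> real^'n \<Rightarrow> nat \<Rightarrow> ereal" where
  "lars_knot X y k =
     (if k = 0 then \<infinity>
      else ereal (Max (lars_ratio X y (lars_path X y (k - 1)) `
                         {j. theta X (lars_path X y (k - 1)) j < 1})))"

text \<open>The maximum is over a nonempty set: $\theta_j < 1$ for one of the two signs of any variable.\<close>

lemma theta_lt_1_nonempty: "{j. theta X idx j < 1} \<noteq> {}"
proof -
  fix v
  have "R_mat X (Inr v) i = - R_mat X (Inl v) i" for i
    by (simp add: R_mat_def sign_of_def var_of_def)
  then have "theta X idx (Inr v) = - theta X idx (Inl v)"
    using mat_inv_M_mat_carrier[of X idx]
    by (simp add: theta_def R_regress_def scalar_prod_def vec_of_list_index sum_negf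
        del: vec_of_list_map)
  then have "theta X idx (Inl v) < 1 \<or> theta X idx (Inr v) < 1" by linarith
  then show ?thesis by blast
qed

definition index_tuples :: "nat \<Rightarrow> ('p + 'p) list set" where
  "index_tuples K = {idx. length idx = K \<and> distinct (map var_of idx)}"

definition irrepresentable_check :: "real^'p^'n \<Rightarrow> ('p + 'p) list \<Rightarrow> bool" where
  "irrepresentable_check X idx \<longleftrightarrow>
     (\<forall>k\<in>{1..length idx}.
        invertible_mat (M_mat X (take k idx)) \<and>
        (\<forall>j. j \<notin> set (take k idx) \<longrightarrow> theta X (take k idx) j < 1))"

text \<open>\<open>rho X idx l\<close> is $\rho_l$ when the first $l$ entries of the path are those of \<open>idx\<close>.\<close>

definition rho :: "real^'p^'n \<Rightarrow> ('p + 'p) list \<Rightarrow> nat \<Rightarrow> real" where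
  "rho X idx l =
     (let j = idx ! (l - 1); prev = take (l - 1) idx in
      if l = 1 then sqrt (R_mat X j j)
      else sqrt (R_mat X j j - R_regress X prev j (map (R_mat X j) prev)) / (1 - theta X prev j))"

definition stopping_rule ::
  "'w measure \<Rightarrow> nat \<Rightarrow> ('w \<Rightarrow> nat \<Rightarrow> ereal) \<Rightarrow> ('w \<Rightarrow> nat \<Rightarrow> 'i) \<Rightarrow> ('w \<Rightarrow> nat) \<Rightarrow> bool" where
  "stopping_rule M K lam ind mhat \<longleftrightarrow>
     mhat \<in> measurable M (count_space UNIV) \<and>
     (\<forall>\<omega>\<in>space M. mhat \<omega> \<in> {0..K - 1}) \<and>
     (\<forall>a\<in>{0..K - 1}.
        \<exists>g \<in> borel_measurable
               (PiM {1..a} (\<lambda>_. borel :: ereal measure) \<Otimes>\<^sub>M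
                PiM {1..K} (\<lambda>_. count_space (UNIV :: 'i set))).
          \<forall>\<omega>\<in>space M.
            (indicator {\<omega>' \<in> space M. mhat \<omega>' \<le> a} \<omega> :: real) =
              g (restrict (lam \<omega>) {1..a}, restrict (ind \<omega>) {1..K}))"


section \<open>The test statistic\<close>

text \<open>
  Distribution functions are taken on the extended reals, so that $\Phi(\infty) = 1$ and, for positive
  scales, $\Phi_i$ is a bijection onto $[0,1]$. This covers $\lambda_0 = \infty$.
\<close>

definition Phi :: "ereal \<Rightarrow> real" where
  "Phi x = measure std_normal_distribution {z. ereal z \<le> x}"

definition Phi_sc :: "real \<Rightarrow> (nat \<Rightarrow> real) \<Rightarrow> nat \<Rightarrow> ereal \<Rightarrow> real" where
  "Phi_sc \<sigma> \<rho> i x = Phi (x / ereal (\<sigma> * \<rho> i))"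

definition F_val :: "real \<Rightarrow> (nat \<Rightarrow> real) \<Rightarrow> (nat \<Rightarrow> ereal) \<Rightarrow> nat \<Rightarrow> real" where
  "F_val \<sigma> \<rho> lam i = (if i = 0 then 1 else Phi_sc \<sigma> \<rho> i (lam i))"

text \<open>$\mathcal P_{i,0}$ is only ever applied to $F_0 = 1$, where its value is $1$ by convention.\<close>

definition P_tr :: "real \<Rightarrow> (nat \<Rightarrow> real) \<Rightarrow> nat \<Rightarrow> nat \<Rightarrow> real \<Rightarrow> real" where
  "P_tr \<sigma> \<rho> i j u = (if j = 0 then 1 else Phi_sc \<sigma> \<rho> i (inv_into UNIV (Phi_sc \<sigma> \<rho> j) u))"

text \<open>
  The integral over $f_{a+1}$ is outermost, and the inner $(b-a-2)$-fold integral is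
  $\mathcal I_{a+1,b}(f_{a+1}, t)$.
\<close>

function I_int :: "real \<Rightarrow> (nat \<Rightarrow> real) \<Rightarrow> nat \<Rightarrow> nat \<Rightarrow> real \<Rightarrow> real \<Rightarrow> real" where
  "I_int \<sigma> \<rho> a b s t =
     (if b \<le> a + 1 then 1
      else LBINT f=ereal (P_tr \<sigma> \<rho> (a + 1) b t)..ereal (P_tr \<sigma> \<rho> (a + 1) a s).
             I_int \<sigma> \<rho> (a + 1) b f t)"
  by pat_completeness auto
termination
  by (relation "Wellfounded.measure (\<lambda>(_, _, a, b, _, _). b - a)") auto

declare I_int.simps [simp del]

definition F_abc ::
  "real \<Rightarrow> (nat \<Rightarrow> real) \<Rightarrow> (nat \<Rightarrow> ereal) \<Rightarrow> nat \<Rightarrow> nat \<Rightarrow> nat \<Rightarrow> ereal \<Rightarrow> real" where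
  "F_abc \<sigma> \<rho> lam a b c t =
     indicator {lam c..lam a} t *
     (LBINT f=ereal (Phi_sc \<sigma> \<rho> b (lam c))..ereal (Phi_sc \<sigma> \<rho> b t).
        I_int \<sigma> \<rho> a b (F_val \<sigma> \<rho> lam a) f * I_int \<sigma> \<rho> b c f (F_val \<sigma> \<rho> lam c))"

definition alpha_hat :: "real \<Rightarrow> real^'p^'n \<Rightarrow> real^'n \<Rightarrow> nat \<Rightarrow> nat \<Rightarrow> nat \<Rightarrow> real" where
  "alpha_hat \<sigma> X y a b c =
     (let \<rho> = (\<lambda>l. rho X (lars_path X y l) l); lam = lars_knot X y in
      1 - F_abc \<sigma> \<rho> lam a b c (lam b) / F_abc \<sigma> \<rho> lam a b c (lam a))"

end

theory Submission
  imports Defs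
begin

text \<open>
  Fix a tuple \<open>idx\<close> satisfying the check. Let $x_i$ be the signed columns, so that $Z_i$ is the inner
  product of $x_i$ and $y$, and let $w_k$ be the residual of $x_{i_k}$ after projection on
  $x_{i_1}, \dots, x_{i_{k-1}}$, divided by $1 - \theta_{i_k}(i_1, \dots, i_{k-1})$. The $w_k$ are
  orthogonal, $w_k$ has length $\rho_k$, and as long as the path follows \<open>idx\<close>, the knot
  $\lambda_k$ is the linear form $L_k = \langle w_k, y \rangle$.

  The first idea is that the selection event is an ordering. Let $U_j$ be the ratio of $j$ after $K$
  steps. Replacing the ratio of $j$ after $k-1$ steps by the ratio after $k$ steps does not change
  on which side of $L_k$ it lies (\<open>lars_ratio_Suc_cmp\<close>). All the argmax conditions therefore collapse
  to $L_1 > \dots > L_K > \max_j U_j$, up to ties, which are hyperplanes and hence null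
  (\<open>lars_path_of_descends\<close>, \<open>descends_of_path\<close>, \<open>AE_tie_free_generic\<close>).

  The second idea replaces a joint density by an invariance. Under the null hypothesis the mean of
  $Y$ is orthogonal to $w_k$ for $k > a$, so the law of $Y$ does not change if the components of $Y$
  along $w_k$, $a < k < c$, are redrawn independently (\<open>nn_integral_noise_law_resample\<close>). Redrawing
  turns $L_k$, $a < k < c$, into independent centred normal variables with standard deviations
  $\sigma\rho_k$ and leaves $\lambda_1, \dots, \lambda_a$, $\lambda_c, \dots, \lambda_{K+1}$ fixed
  (\<open>tuple_knot_resample\<close>), hence also the event $\hat m \le a$. Given everything that is kept, the
  only remaining condition is that the fresh values descend from $\lambda_a$ to $\lambda_c$.

  The third idea is that the statistic is a conditional distribution function. The substitution
  $f_i = \Phi_i(\ell_i)$ turns $\mathbb F_{abc}(t)$ into the probability that the fresh values descend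
  from $\lambda_a$ to $\lambda_c$ and the $b$-th one lies below $t$ (\<open>F_abc_eq_chain_measure\<close>).
  So $\mathbb F_{abc}(\lambda_b) / \mathbb F_{abc}(\lambda_a)$ is the conditional distribution function
  of $\lambda_b$ evaluated at $\lambda_b$ itself, and is uniform by the probability integral transform
  (\<open>alpha_uniform_on_chain\<close>). Integrating over what was kept gives the theorem.

  If $c = K + 1$, the scale $\rho_{K+1}$ is random, but it enters $\mathbb F_{abc}$ only through
  $\Phi_c$ followed by $\Phi_c^{-1}$ and cancels (\<open>F_abc_scale_cong\<close>) as soon as it is positive. This
  is where $K$ being less than the rank of $X$ is used (\<open>last_rho_pos\<close>).
\<close>

no_notation Matrix.scalar_prod (infix "\<bullet>" 70)


section \<open>Resampling Gaussian noise along orthogonal directions\<close>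

text \<open>
  As an image of the standard normal law this is a probability measure for every \<open>\<tau>\<close>, including
  \<open>0\<close>, so that products over arbitrary index sets need no side conditions.
\<close>

definition gauss :: "real \<Rightarrow> real measure" where
  "gauss \<tau> = distr std_normal_distribution borel ((*) \<tau>)"

lemma sets_gauss [simp, measurable_cong]: "sets (gauss \<tau>) = sets borel"
  by (simp add: gauss_def)

lemma space_gauss [simp]: "space (gauss \<tau>) = UNIV"
  by (simp add: gauss_def)

lemma prob_space_gauss: "prob_space (gauss \<tau>)"
  unfolding gauss_def
  by (intro prob_space.prob_space_distr prob_space_normal_density) simp_all

definition noise_law :: "real \<Rightarrow> (real^'n) measure" where
  "noise_law \<sigma> = density lborel (\<lambda>x. ennreal (\<Prod>i\<in>UNIV. normal_density 0 \<sigma> (x $ i)))"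

lemma sets_noise_law [simp, measurable_cong]: "sets (noise_law \<sigma>) = sets borel"
  by (simp add: noise_law_def)

lemma space_noise_law [simp]: "space (noise_law \<sigma>) = UNIV"
  by (simp add: noise_law_def)

lemma noise_density_eq:
  fixes y :: "real^'n"
  shows "(\<Prod>i\<in>UNIV. normal_density 0 \<sigma> (y $ i)) =
    (1 / sqrt (2 * pi * \<sigma>\<^sup>2)) ^ CARD('n) * exp (- (y \<bullet> y) / (2 * \<sigma>\<^sup>2))"
proof -
  have "(\<Prod>i\<in>UNIV. normal_density 0 \<sigma> (y $ i)) =
      (\<Prod>i\<in>(UNIV::'n set). 1 / sqrt (2 * pi * \<sigma>\<^sup>2)) * (\<Prod>i\<in>UNIV. exp (- (y $ i)\<^sup>2 / (2 * \<sigma>\<^sup>2)))"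
    unfolding normal_density_def prod.distrib by simp
  also have "(\<Prod>i\<in>UNIV. exp (- (y $ i)\<^sup>2 / (2 * \<sigma>\<^sup>2))) = exp (\<Sum>i\<in>UNIV. - (y $ i)\<^sup>2 / (2 * \<sigma>\<^sup>2))"
    by (simp add: exp_sum)
  also have "(\<Sum>i\<in>UNIV. - (y $ i)\<^sup>2 / (2 * \<sigma>\<^sup>2)) = - (y \<bullet> y) / (2 * \<sigma>\<^sup>2)"
    by (simp add: inner_vec_def power2_eq_square sum_negf flip: sum_divide_distrib)
  finally show ?thesis by simp
qed

text \<open>
  The theorem of Pythagoras in the direction \<open>e\<close>: up to the same constant, both sides are
  $\exp(-(|y|^2 + (t - \langle e, y \rangle)^2) / (2\sigma^2))$.
\<close>

lemma noise_density_rotate: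
  fixes y e :: "real^'n"
  assumes e: "e \<bullet> e = 1"
  shows "normal_density 0 \<sigma> (e \<bullet> y) * (\<Prod>i\<in>UNIV. normal_density 0 \<sigma> ((y - t *\<^sub>R e) $ i)) =
    normal_density (e \<bullet> y) \<sigma> t * (\<Prod>i\<in>UNIV. normal_density 0 \<sigma> (y $ i))"
proof -
  have "(e \<bullet> y)\<^sup>2 + (y - t *\<^sub>R e) \<bullet> (y - t *\<^sub>R e) = (t - e \<bullet> y)\<^sup>2 + y \<bullet> y"
    using e by (simp add: inner_diff_left inner_diff_right inner_commute power2_eq_square algebra_simps)
  then have "exp (- (e \<bullet> y)\<^sup>2 / (2 * \<sigma>\<^sup>2)) * exp (- ((y - t *\<^sub>R e) \<bullet> (y - t *\<^sub>R e)) / (2 * \<sigma>\<^sup>2)) =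
      exp (- (t - e \<bullet> y)\<^sup>2 / (2 * \<sigma>\<^sup>2)) * exp (- (y \<bullet> y) / (2 * \<sigma>\<^sup>2))"
    unfolding exp_add[symmetric] add_divide_distrib[symmetric] by (metis minus_add_distrib)
  then show ?thesis
    unfolding noise_density_eq unfolding normal_density_def by (simp add: mult_ac)
qed

lemma nn_integral_gauss:
  assumes "\<tau> > 0" and [measurable]: "f \<in> borel_measurable borel"
  shows "(\<integral>\<^sup>+s. f s \<partial>gauss \<tau>) = (\<integral>\<^sup>+t. ennreal (normal_density 0 \<tau> t) * f t \<partial>lborel)"
proof -
  have "(\<integral>\<^sup>+t. ennreal (normal_density 0 \<tau> t) * f t \<partial>lborel) =
      ennreal \<bar>\<tau>\<bar> * (\<integral>\<^sup>+z. ennreal (normal_density 0 \<tau> (0 + \<tau> * z)) * f (0 + \<tau> * z) \<partial>lborel)"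
    using assms by (intro nn_integral_real_affine) auto
  also have "\<dots> = (\<integral>\<^sup>+z. ennreal (\<bar>\<tau>\<bar> * normal_density 0 \<tau> (\<tau> * z)) * f (\<tau> * z) \<partial>lborel)"
    by (simp add: ennreal_mult mult.assoc flip: nn_integral_cmult)
  also have "\<dots> = (\<integral>\<^sup>+z. ennreal (std_normal_density z) * f (\<tau> * z) \<partial>lborel)"
    using assms(1) by (simp add: normal_density_def real_sqrt_mult power_mult_distrib field_simps)
  also have "\<dots> = (\<integral>\<^sup>+s. f s \<partial>gauss \<tau>)"
    by (simp add: gauss_def nn_integral_distr nn_integral_density)
  finally show ?thesis by simp
qed

lemma nn_integral_lborel_shift:
  fixes f :: "'a::euclidean_space \<Rightarrow> ennreal"
  assumes [measurable]: "f \<in> borel_measurable borel"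
  shows "(\<integral>\<^sup>+y. f (c + y) \<partial>lborel) = (\<integral>\<^sup>+y. f y \<partial>lborel)"
proof -
  have "(\<integral>\<^sup>+y. f y \<partial>lborel) = (\<integral>\<^sup>+y. f y \<partial>distr lborel borel ((+) c))"
    by (simp add: lborel_distr_plus)
  also have "\<dots> = (\<integral>\<^sup>+y. f (c + y) \<partial>lborel)"
    by (subst nn_integral_distr) auto
  finally show ?thesis by simp
qed

lemma borel_measurable_vec_component [measurable]:
  "f \<in> borel_measurable M \<Longrightarrow> (\<lambda>x. (f x :: real^'n) $ i) \<in> borel_measurable M"
  by (rule measurable_compose[OF _ borel_measurable_continuous_onI])
    (auto intro: continuous_intros)

text \<open>
  The component along \<open>e\<close> may be redrawn independently. By translation invariance of Lebesgue
  measure, $t$ may be replaced by $t + \langle e, y \rangle$ in the inner integral and then $y$ by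
  $y - t e$ in the outer one. By \<open>noise_density_rotate\<close>, what depends on $t$ is then a normal density,
  which integrates to 1.
\<close>

lemma nn_integral_noise_law_resample_unit:
  fixes e :: "real^'n" and f :: "real^'n \<Rightarrow> ennreal"
  assumes "\<sigma> > 0" and e: "e \<bullet> e = 1" and [measurable]: "f \<in> borel_measurable borel"
  shows "(\<integral>\<^sup>+y. \<integral>\<^sup>+t. f (y + (t - e \<bullet> y) *\<^sub>R e) \<partial>gauss \<sigma> \<partial>noise_law \<sigma>) = (\<integral>\<^sup>+y. f y \<partial>noise_law \<sigma>)"
proof -
  let ?n = "\<lambda>t. ennreal (normal_density 0 \<sigma> t)"
  let ?G = "\<lambda>y::real^'n. ennreal (\<Prod>i\<in>UNIV. normal_density 0 \<sigma> (y $ i))"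
  interpret gauss: prob_space "gauss \<sigma>" by (rule prob_space_gauss)
  have nonneg: "0 \<le> (\<Prod>i\<in>UNIV. normal_density 0 \<sigma> (y $ i))" for y :: "real^'n"
    by (simp add: prod_nonneg)
  have rotate: "?n (e \<bullet> y) * ?G (y - t *\<^sub>R e) = ennreal (normal_density (e \<bullet> y) \<sigma> t) * ?G y" for t y
    unfolding ennreal_mult''[OF nonneg, symmetric] noise_density_rotate[OF e] ..
  have "(\<integral>\<^sup>+y. \<integral>\<^sup>+t. f (y + (t - e \<bullet> y) *\<^sub>R e) \<partial>gauss \<sigma> \<partial>noise_law \<sigma>) =
      (\<integral>\<^sup>+y. ?G y * (\<integral>\<^sup>+t. f (y + (t - e \<bullet> y) *\<^sub>R e) \<partial>gauss \<sigma>) \<partial>lborel)"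
    unfolding noise_law_def by (subst nn_integral_density) auto
  also have "\<dots> = (\<integral>\<^sup>+y. \<integral>\<^sup>+t. ?n (e \<bullet> y + t) * (?G y * f (y + t *\<^sub>R e)) \<partial>lborel \<partial>lborel)"
  proof (rule nn_integral_cong)
    fix y
    have "(\<integral>\<^sup>+t. f (y + (t - e \<bullet> y) *\<^sub>R e) \<partial>gauss \<sigma>) =
        (\<integral>\<^sup>+t. ?n t * f (y + (t - e \<bullet> y) *\<^sub>R e) \<partial>lborel)"
      using assms by (intro nn_integral_gauss) auto
    also have "\<dots> = (\<integral>\<^sup>+t. ?n (e \<bullet> y + t) * f (y + (e \<bullet> y + t - e \<bullet> y) *\<^sub>R e) \<partial>lborel)"
      by (subst nn_integral_lborel_shift[where c = "e \<bullet> y", symmetric]) auto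
    finally show "?G y * (\<integral>\<^sup>+t. f (y + (t - e \<bullet> y) *\<^sub>R e) \<partial>gauss \<sigma>) =
        (\<integral>\<^sup>+t. ?n (e \<bullet> y + t) * (?G y * f (y + t *\<^sub>R e)) \<partial>lborel)"
      by (simp add: mult_ac flip: nn_integral_cmult)
  qed
  also have "\<dots> = (\<integral>\<^sup>+t. \<integral>\<^sup>+y. ?n (e \<bullet> y + t) * (?G y * f (y + t *\<^sub>R e)) \<partial>lborel \<partial>lborel)"
    by (rule lborel_pair.Fubini') measurable
  also have "\<dots> = (\<integral>\<^sup>+t. \<integral>\<^sup>+y. ?n (e \<bullet> y) * ?G (y - t *\<^sub>R e) * f y \<partial>lborel \<partial>lborel)"
  proof (rule nn_integral_cong)
    fix t
    have "(\<integral>\<^sup>+y. ?n (e \<bullet> y + t) * (?G y * f (y + t *\<^sub>R e)) \<partial>lborel) =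
        (\<integral>\<^sup>+y. ?n (e \<bullet> (- t *\<^sub>R e + y) + t) *
           (?G (- t *\<^sub>R e + y) * f (- t *\<^sub>R e + y + t *\<^sub>R e)) \<partial>lborel)"
      by (subst nn_integral_lborel_shift[where c = "- t *\<^sub>R e", symmetric]) auto
    then show "(\<integral>\<^sup>+y. ?n (e \<bullet> y + t) * (?G y * f (y + t *\<^sub>R e)) \<partial>lborel) =
        (\<integral>\<^sup>+y. ?n (e \<bullet> y) * ?G (y - t *\<^sub>R e) * f y \<partial>lborel)"
      using e by (simp add: inner_add_right inner_diff_right mult.assoc)
  qed
  also have "\<dots> = (\<integral>\<^sup>+t. \<integral>\<^sup>+y. ennreal (normal_density (e \<bullet> y) \<sigma> t) * (?G y * f y) \<partial>lborel \<partial>lborel)"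
    by (intro nn_integral_cong) (subst rotate, rule mult.assoc)
  also have "\<dots> = (\<integral>\<^sup>+y. \<integral>\<^sup>+t. ennreal (normal_density (e \<bullet> y) \<sigma> t) * (?G y * f y) \<partial>lborel \<partial>lborel)"
    by (rule lborel_pair.Fubini'[symmetric]) (unfold normal_density_def, measurable)
  also have "\<dots> = (\<integral>\<^sup>+y. ?G y * f y \<partial>lborel)"
  proof (rule nn_integral_cong)
    fix y
    have "(\<integral>\<^sup>+t. ennreal (normal_density (e \<bullet> y) \<sigma> t) \<partial>lborel) = 1"
      using assms by (subst nn_integral_eq_integral) auto
    then show "(\<integral>\<^sup>+t. ennreal (normal_density (e \<bullet> y) \<sigma> t) * (?G y * f y) \<partial>lborel) = ?G y * f y"
      by (simp add: nn_integral_multc)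
  qed
  also have "\<dots> = (\<integral>\<^sup>+y. f y \<partial>noise_law \<sigma>)"
    unfolding noise_law_def by (subst nn_integral_density) auto
  finally show ?thesis .
qed

lemma nn_integral_noise_law_resample_along:
  fixes w :: "real^'n" and f :: "real^'n \<Rightarrow> ennreal"
  assumes "\<sigma> > 0" and w: "w \<noteq> 0" and [measurable]: "f \<in> borel_measurable borel"
  shows "(\<integral>\<^sup>+y. \<integral>\<^sup>+s. f (y + ((s - w \<bullet> y) / (w \<bullet> w)) *\<^sub>R w) \<partial>gauss (\<sigma> * norm w) \<partial>noise_law \<sigma>) =
    (\<integral>\<^sup>+y. f y \<partial>noise_law \<sigma>)"
proof -
  define e where "e = (1 / norm w) *\<^sub>R w"
  have e: "e \<bullet> e = 1" using w by (simp add: e_def dot_square_norm power2_eq_square)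
  have "((\<sigma> * norm w * z - w \<bullet> y) / (w \<bullet> w)) *\<^sub>R w = (\<sigma> * z - e \<bullet> y) *\<^sub>R e" for z y
    using w by (simp add: e_def dot_square_norm power2_eq_square field_simps)
  then have "(\<integral>\<^sup>+s. f (y + ((s - w \<bullet> y) / (w \<bullet> w)) *\<^sub>R w) \<partial>gauss (\<sigma> * norm w)) =
      (\<integral>\<^sup>+t. f (y + (t - e \<bullet> y) *\<^sub>R e) \<partial>gauss \<sigma>)" for y
    unfolding gauss_def by (simp add: nn_integral_distr)
  then show ?thesis using nn_integral_noise_law_resample_unit[OF assms(1) e assms(3)] by simp
qed

text \<open>
  Directions can be treated one at a time: by orthogonality, redrawing the component along one of
  them does not affect the components along the others.
\<close>

lemma nn_integral_noise_law_resample: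
  fixes w :: "'i \<Rightarrow> real^'n" and f :: "real^'n \<Rightarrow> ennreal"
  assumes "\<sigma> > 0" and "finite I" and "\<And>i. i \<in> I \<Longrightarrow> w i \<noteq> 0"
    and "\<And>i j. i \<in> I \<Longrightarrow> j \<in> I \<Longrightarrow> i \<noteq> j \<Longrightarrow> w i \<bullet> w j = 0"
    and "f \<in> borel_measurable borel"
  shows "(\<integral>\<^sup>+y. \<integral>\<^sup>+s. f (y + (\<Sum>i\<in>I. ((s i - w i \<bullet> y) / (w i \<bullet> w i)) *\<^sub>R w i))
      \<partial>PiM I (\<lambda>i. gauss (\<sigma> * norm (w i))) \<partial>noise_law \<sigma>) = (\<integral>\<^sup>+y. f y \<partial>noise_law \<sigma>)"
  using assms(2-5)
proof (induction I)
  case empty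
  interpret product_sigma_finite "\<lambda>i. gauss (\<sigma> * norm (w i))"
    by (intro product_sigma_finite.intro prob_space_imp_sigma_finite prob_space_gauss)
  show ?case by (simp add: PiM_empty nn_integral_count_space_finite)
next
  case (insert i I)
  interpret product_sigma_finite "\<lambda>i. gauss (\<sigma> * norm (w i))"
    by (intro product_sigma_finite.intro prob_space_imp_sigma_finite prob_space_gauss)
  interpret I: sigma_finite_measure "PiM I (\<lambda>i. gauss (\<sigma> * norm (w i)))"
    using insert by (intro sigma_finite) auto
  have [measurable]: "f \<in> borel_measurable borel" by fact
  let ?g = "\<lambda>y. \<integral>\<^sup>+s. f (y + (\<Sum>k\<in>I. ((s k - w k \<bullet> y) / (w k \<bullet> w k)) *\<^sub>R w k))
      \<partial>PiM I (\<lambda>i. gauss (\<sigma> * norm (w i)))"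
  have [measurable]: "?g \<in> borel_measurable borel" by measurable
  have step: "(\<integral>\<^sup>+s. f (y + (\<Sum>k\<in>insert i I. ((s k - w k \<bullet> y) / (w k \<bullet> w k)) *\<^sub>R w k))
        \<partial>PiM (insert i I) (\<lambda>i. gauss (\<sigma> * norm (w i)))) =
      (\<integral>\<^sup>+t. ?g (y + ((t - w i \<bullet> y) / (w i \<bullet> w i)) *\<^sub>R w i) \<partial>gauss (\<sigma> * norm (w i)))" for y
  proof (subst product_nn_integral_insert_rev[OF insert(1,2)], measurable, intro nn_integral_cong)
    fix t s
    let ?u = "((t - w i \<bullet> y) / (w i \<bullet> w i)) *\<^sub>R w i"
    have "(\<Sum>k\<in>I. (((s(i := t)) k - w k \<bullet> y) / (w k \<bullet> w k)) *\<^sub>R w k) =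
        (\<Sum>k\<in>I. ((s k - w k \<bullet> (y + ?u)) / (w k \<bullet> w k)) *\<^sub>R w k)"
    proof (rule sum.cong)
      fix k assume "k \<in> I"
      then have "k \<noteq> i" "w k \<bullet> w i = 0" using insert by auto
      then show "(((s(i := t)) k - w k \<bullet> y) / (w k \<bullet> w k)) *\<^sub>R w k =
          ((s k - w k \<bullet> (y + ?u)) / (w k \<bullet> w k)) *\<^sub>R w k"
        by (simp add: inner_add_right)
    qed simp
    then show "f (y + (\<Sum>k\<in>insert i I. (((s(i := t)) k - w k \<bullet> y) / (w k \<bullet> w k)) *\<^sub>R w k)) =
        f (y + ?u + (\<Sum>k\<in>I. ((s k - w k \<bullet> (y + ?u)) / (w k \<bullet> w k)) *\<^sub>R w k))"
      using insert by (simp add: add.assoc)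
  qed
  have "(\<integral>\<^sup>+y. ?g y \<partial>noise_law \<sigma>) = (\<integral>\<^sup>+y. f y \<partial>noise_law \<sigma>)"
    using insert by auto
  moreover have "(\<integral>\<^sup>+y. \<integral>\<^sup>+t. ?g (y + ((t - w i \<bullet> y) / (w i \<bullet> w i)) *\<^sub>R w i) \<partial>gauss (\<sigma> * norm (w i)) \<partial>noise_law \<sigma>)
      = (\<integral>\<^sup>+y. ?g y \<partial>noise_law \<sigma>)"
    using insert by (intro nn_integral_noise_law_resample_along \<open>\<sigma> > 0\<close>) auto
  ultimately show ?case unfolding step by simp
qed

lemma AE_noise_law_hyperplane:
  fixes v :: "real^'n"
  assumes "v \<noteq> 0"
  shows "AE y in noise_law \<sigma>. v \<bullet> y \<noteq> c"
proof -
  have "{y. v \<bullet> y = c} \<in> null_sets lborel"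
    using negligible_hyperplane[of v c] assms
    by (subst null_sets_completion_iff[symmetric]) (auto simp: negligible_iff_null_sets)
  then have "AE y in lborel. v \<bullet> y \<noteq> c" by (rule AE_I') auto
  then show ?thesis unfolding noise_law_def by (subst AE_density) auto
qed


section \<open>The probability integral transform\<close>

abbreviation unif :: "real measure" where
  "unif \<equiv> uniform_measure lborel {0<..<1}"

lemma prob_space_unif: "prob_space unif"
  by (intro prob_space_uniform_measure) auto

lemma measure_unif: "A \<in> sets borel \<Longrightarrow> measure unif A = measure lborel ({0<..<1} \<inter> A)"
  by (subst measure_uniform_measure) auto

lemma real_distribution_unif: "real_distribution unif"
  by (intro real_distribution.intro prob_space_unif real_distribution_axioms.intro) auto

text \<open>
  Outside $(0,1)$ the distribution function is forced by monotonicity.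
\<close>

lemma eq_unifI:
  assumes "real_distribution Q" and cdf: "\<And>u. 0 < u \<Longrightarrow> u < 1 \<Longrightarrow> cdf Q u = u"
  shows "Q = unif"
proof (rule cdf_unique[OF assms(1) real_distribution_unif], rule ext)
  interpret real_distribution Q by fact
  fix u :: real
  consider "u \<le> 0" | "0 < u" "u < 1" | "1 \<le> u" by linarith
  then show "cdf Q u = cdf unif u"
  proof cases
    case 1
    have "cdf Q u \<le> e" if "0 < e" for e
    proof -
      have "cdf Q u \<le> cdf Q (min e (1/2))" using 1 that by (intro cdf_nondecreasing) auto
      also have "\<dots> = min e (1/2)" using that by (intro cdf) auto
      finally show ?thesis by linarith
    qed
    then have "cdf Q u \<le> 0" using field_le_epsilon[of "cdf Q u" 0] by simp
    then have "cdf Q u = 0" using cdf_nonneg[of u] by linarith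
    moreover have "{0<..<1} \<inter> {..u} = {}" using 1 by auto
    ultimately show ?thesis by (simp add: cdf_def measure_unif)
  next
    case 2
    then have "{0<..<1} \<inter> {..u} = {0<..u}" by auto
    then show ?thesis using 2 cdf[of u] by (simp add: cdf_def measure_unif)
  next
    case 3
    have "cdf Q u \<ge> e" if "e < 1" for e
    proof -
      have "max e (1/2) = cdf Q (max e (1/2))" using that by (intro cdf[symmetric]) auto
      also have "\<dots> \<le> cdf Q u" using 3 that by (intro cdf_nondecreasing) auto
      finally show ?thesis by linarith
    qed
    then have "cdf Q u \<ge> 1" using dense_le[of 1 "cdf Q u"] by simp
    then have "cdf Q u = 1" using cdf_bounded_prob[of u] by simp
    moreover have "{0<..<1} \<inter> {..u} = {0<..<1}" using 3 by auto
    ultimately show ?thesis by (simp add: cdf_def measure_unif)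
  qed
qed

lemma atomless_cdf_attains:
  assumes "real_distribution Q" and "\<And>x. measure Q {x} = 0" and u: "0 < u" "u < 1"
  shows "\<exists>t. cdf Q t = u"
proof -
  interpret real_distribution Q by fact
  have cont: "isCont (cdf Q) x" for x using assms(2) isCont_cdf by simp
  have "eventually (\<lambda>t. cdf Q t < u) at_bot" using cdf_lim_at_bot u(1) by (rule order_tendstoD(2))
  then obtain p where p: "cdf Q p < u" unfolding eventually_at_bot_linorder by auto
  have "eventually (\<lambda>t. cdf Q t > u) at_top" using cdf_lim_at_top_prob u(2) by (rule order_tendstoD(1))
  then obtain q where q: "cdf Q q > u" unfolding eventually_at_top_linorder by auto
  have "p \<le> q" using cdf_nondecreasing[of q p] p q by linarith
  then show ?thesis using IVT[of "cdf Q" p u q] p q cont by auto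
qed

text \<open>
  If the distribution function attains $u$ at $t$, then the set where it is at most $u$ contains
  \<open>{..t}\<close>, and it lies below any point where a value $v > u$ is attained. So its measure lies between
  $u$ and every such $v$. Without atoms all values in $(0,1)$ are attained.
\<close>

lemma prob_integral_transform:
  assumes Q: "real_distribution Q" and atomless: "\<And>x. measure Q {x} = 0"
  shows "distr Q borel (cdf Q) = unif"
proof (rule eq_unifI)
  interpret real_distribution Q by fact
  have [measurable]: "cdf Q \<in> borel_measurable borel"
    by (intro borel_measurable_mono monoI cdf_nondecreasing)
  show "real_distribution (distr Q borel (cdf Q))"
    by (intro real_distribution_distr) auto
  fix u :: real assume u: "0 < u" "u < 1"
  have eq: "cdf (distr Q borel (cdf Q)) u = measure Q {x. cdf Q x \<le> u}"
    unfolding cdf_def[of "distr Q borel (cdf Q)"] by (subst measure_distr) (auto simp: vimage_def)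
  obtain t where t: "cdf Q t = u" using atomless_cdf_attains[OF Q atomless u] by blast
  have "cdf Q t \<le> measure Q {x. cdf Q x \<le> u}"
    unfolding cdf_def2[of Q t]
  proof (rule finite_measure_mono)
    show "{..t} \<subseteq> {x. cdf Q x \<le> u}" using cdf_nondecreasing[of _ t] t by blast
  qed simp
  moreover have "measure Q {x. cdf Q x \<le> u} \<le> v" if v: "u < v" for v
  proof (cases "v < 1")
    case True
    then obtain r where r: "cdf Q r = v" using atomless_cdf_attains[OF Q atomless, of v] u v by auto
    have "x \<le> r" if "cdf Q x \<le> u" for x
      using that r v cdf_nondecreasing[of r x] by linarith
    then have "{x. cdf Q x \<le> u} \<subseteq> {..r}" by blast
    then have "measure Q {x. cdf Q x \<le> u} \<le> cdf Q r" unfolding cdf_def2[of Q r] by (intro finite_measure_mono) auto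
    then show ?thesis using r by simp
  next
    case False
    then show ?thesis using prob_le_1[of "{x. cdf Q x \<le> u}"] by linarith
  qed
  then have "measure Q {x. cdf Q x \<le> u} \<le> u" by (rule dense_ge)
  ultimately show "cdf (distr Q borel (cdf Q)) u = u" using eq t by simp
qed

lemma distr_unif_reflect: "distr unif borel (\<lambda>x. 1 - x) = unif"
proof (rule eq_unifI)
  interpret prob_space unif by (rule prob_space_unif)
  show "real_distribution (distr unif borel (\<lambda>x. 1 - x))"
    by (intro real_distribution_distr) auto
  fix u :: real assume u: "0 < u" "u < 1"
  have "{0<..<1} \<inter> {x. 1 - x \<le> u} = {1 - u..<1}" using u by auto
  then show "cdf (distr unif borel (\<lambda>x. 1 - x)) u = u"
    using u by (simp add: cdf_def measure_distr vimage_def measure_unif)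
qed


text \<open>
  The quotient is the distribution function of \<open>V\<close> under the law conditioned on \<open>S\<close>, evaluated at \<open>V\<close>;
  strict and non-strict inequalities agree because \<open>V\<close> has no atoms. The product form makes sense also
  for a null set \<open>S\<close>, where conditioning does not. This matters when it is integrated over a parameter.
\<close>

lemma conditional_survival_uniform:
  fixes \<mu> :: "'a measure" and V :: "'a \<Rightarrow> real"
  assumes "prob_space \<mu>" and S: "S \<in> sets \<mu>" and V [measurable]: "V \<in> borel_measurable \<mu>"
    and atomless: "\<And>x. measure \<mu> {s \<in> space \<mu>. V s = x} = 0"
    and B: "B \<in> sets borel"
  shows "emeasure \<mu> {s \<in> S. 1 - measure \<mu> {r \<in> S. V r < V s} / measure \<mu> S \<in> B} =
    emeasure \<mu> S * emeasure unif B"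
proof (cases "emeasure \<mu> S = 0")
  case True
  have "emeasure \<mu> {s \<in> S. 1 - measure \<mu> {r \<in> S. V r < V s} / measure \<mu> S \<in> B} \<le> emeasure \<mu> S"
    using S by (intro emeasure_mono) auto
  then show ?thesis using True by simp
next
  case False
  interpret prob_space \<mu> by fact
  note [measurable] = S
  let ?\<nu> = "uniform_measure \<mu> S"
  interpret \<nu>: prob_space ?\<nu> using False by (intro prob_space_uniform_measure) auto
  define Q where "Q = distr ?\<nu> borel V"
  have Q: "real_distribution Q" unfolding Q_def by (intro \<nu>.real_distribution_distr) simp
  interpret Q: real_distribution Q by fact
  have mQ: "measure Q A = measure \<mu> {s \<in> S. V s \<in> A} / measure \<mu> S" if [measurable]: "A \<in> sets borel" for A
  proof -
    have "{s \<in> S. V s \<in> A} = S \<inter> (V -` A \<inter> space \<mu>)" using sets.sets_into_space[OF S] by auto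
    moreover have "measure Q A = measure ?\<nu> (V -` A \<inter> space \<mu>)"
      unfolding Q_def by (subst measure_distr) auto
    moreover have "measure ?\<nu> (V -` A \<inter> space \<mu>) = measure \<mu> (S \<inter> (V -` A \<inter> space \<mu>)) / measure \<mu> S"
      using False by (intro measure_uniform_measure) auto
    ultimately show ?thesis by simp
  qed
  have atomlessQ: "measure Q {x} = 0" for x
  proof -
    have "measure \<mu> {s \<in> S. V s \<in> {x}} \<le> measure \<mu> {s \<in> space \<mu>. V s = x}"
      using sets.sets_into_space[OF S] by (intro finite_measure_mono) auto
    then show ?thesis using atomless[of x] mQ[of "{x}"] by (simp add: measure_le_0_iff)
  qed
  have cdfQ: "measure \<mu> {r \<in> S. V r < t} / measure \<mu> S = cdf Q t" for t
  proof -
    have "{..t} = {..<t} \<union> {t}" by auto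
    then have "cdf Q t = measure Q ({..<t} \<union> {t})" by (simp add: cdf_def)
    also have "\<dots> = measure Q {..<t}" using atomlessQ[of t]
      by (subst Q.finite_measure_Union) auto
    finally show ?thesis using mQ[of "{..<t}"] by simp
  qed
  have [measurable]: "cdf Q \<in> borel_measurable borel"
    by (intro borel_measurable_mono monoI Q.cdf_nondecreasing)
  note [measurable] = B
  let ?A = "{x. 1 - cdf Q x \<in> B}"
  have A [measurable]: "?A \<in> sets borel" by measurable
  have SA: "{s \<in> S. 1 - cdf Q (V s) \<in> B} = S \<inter> (V -` ?A \<inter> space \<mu>)"
    using sets.sets_into_space[OF S] by auto
  have "emeasure \<mu> {s \<in> S. 1 - cdf Q (V s) \<in> B} / emeasure \<mu> S = emeasure ?\<nu> (V -` ?A \<inter> space \<mu>)"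
    unfolding SA by (subst emeasure_uniform_measure) (use measurable_sets[OF V A] in auto)
  also have "\<dots> = emeasure Q ?A"
    using emeasure_distr[of V ?\<nu> borel ?A] A V by (simp add: Q_def)
  also have "\<dots> = emeasure (distr (distr Q borel (cdf Q)) borel (\<lambda>x. 1 - x)) B"
    by (subst emeasure_distr, simp, simp, subst emeasure_distr) (auto simp: vimage_def)
  also have "\<dots> = emeasure unif B"
    by (simp add: prob_integral_transform[OF Q atomlessQ] distr_unif_reflect)
  finally have "emeasure \<mu> {s \<in> S. 1 - cdf Q (V s) \<in> B} / emeasure \<mu> S = emeasure unif B" .
  moreover have "x / emeasure \<mu> S * emeasure \<mu> S = x" for x
    using False by (subst ennreal_divide_times, subst ennreal_divide_self) (auto simp: less_top[symmetric])
  ultimately show ?thesis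
    unfolding cdfQ by (metis mult.commute)
qed


section \<open>The normal distribution function and its inverse\<close>

lemma measure_gauss_Ioc_pos:
  assumes "\<tau> > 0" "x < y" shows "measure (gauss \<tau>) {x<..y} > 0"
proof -
  interpret prob_space "gauss \<tau>" by (rule prob_space_gauss)
  have "gauss \<tau> = density lborel (normal_density 0 \<tau>)"
  proof (rule measure_eqI)
    fix A assume "A \<in> sets (gauss \<tau>)"
    then have [measurable]: "A \<in> sets borel" by simp
    have "emeasure (gauss \<tau>) A = (\<integral>\<^sup>+s. indicator A s \<partial>gauss \<tau>)" by simp
    also have "\<dots> = emeasure (density lborel (normal_density 0 \<tau>)) A"
      using assms by (subst nn_integral_gauss) (auto simp: emeasure_density)
    finally show "emeasure (gauss \<tau>) A = emeasure (density lborel (normal_density 0 \<tau>)) A" .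
  qed simp
  moreover have "{x<..y} \<notin> null_sets (density lborel (normal_density 0 \<tau>))"
  proof
    assume "{x<..y} \<in> null_sets (density lborel (normal_density 0 \<tau>))"
    then have "AE s in lborel. s \<in> {x<..y} \<longrightarrow> ennreal (normal_density 0 \<tau> s) = 0"
      by (subst (asm) null_sets_density_iff) auto
    then have "AE s in lborel. s \<notin> {x<..y}"
    proof eventually_elim
      case (elim s) then show ?case using normal_density_pos[of \<tau> 0 s] assms by (auto simp: ennreal_eq_0_iff)
    qed
    moreover have "{s \<in> space lborel. \<not> s \<notin> {x<..y}} = {x<..y}" by auto
    ultimately have "emeasure lborel {x<..y} = 0"
      using AE_iff_measurable[of "{x<..y}" lborel "\<lambda>s. s \<notin> {x<..y}"] by simp
    then show False using assms by simp
  qed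
  ultimately have "emeasure (gauss \<tau>) {x<..y} \<noteq> 0" by (auto simp: null_sets_def)
  then show ?thesis by (simp add: emeasure_eq_measure less_le)
qed

lemma measure_gauss_singleton:
  assumes "\<tau> > 0" shows "measure (gauss \<tau>) {x} = 0"
proof -
  have "emeasure (gauss \<tau>) {x} = (\<integral>\<^sup>+s. indicator {x} s \<partial>gauss \<tau>)" by simp
  also have "\<dots> = (\<integral>\<^sup>+t. ennreal (normal_density 0 \<tau> t) * indicator {x} t \<partial>lborel)"
    using assms by (subst nn_integral_gauss) auto
  also have "\<dots> = 0"
  proof (subst nn_integral_0_iff_AE)
    show "AE t in lborel. ennreal (normal_density 0 \<tau> t) * indicator {x} t = 0"
      using AE_lborel_singleton[of x] by eventually_elim simp
  qed measurable
  finally show ?thesis by (simp add: measure_def)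
qed

lemma real_distribution_gauss: "real_distribution (gauss \<tau>)"
  by (intro real_distribution.intro prob_space_gauss real_distribution_axioms.intro) simp

lemma gauss_1: "gauss 1 = std_normal_distribution"
  unfolding gauss_def by (simp add: distr_id2 sets_density cong: distr_cong)

lemma Phi_ereal [simp]: "Phi (ereal x) = cdf (gauss 1) x"
  by (simp add: Phi_def cdf_def gauss_1 atMost_def)

lemma Phi_infinity [simp]: "Phi \<infinity> = 1" "Phi (- \<infinity>) = 0"
  using prob_space.prob_space[OF prob_space_normal_density[of 1 0]]
  by (simp_all add: Phi_def)

lemma strict_mono_Phi: "strict_mono Phi"
proof (rule strict_monoI)
  fix x y :: ereal assume "x < y"
  interpret prob_space "gauss 1" by (rule prob_space_gauss)
  have D: "measure std_normal_distribution A = measure (gauss 1) A" for A by (simp add: gauss_1)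
  obtain p where p: "x < ereal p" "ereal p < y" using ereal_dense2[OF \<open>x < y\<close>] by blast
  obtain q where q: "ereal p < ereal q" "ereal q < y" using ereal_dense2[OF p(2)] by blast
  have [measurable]: "{z. ereal z \<le> v} \<in> sets borel" for v by measurable
  \<comment> \<open>an interval of positive mass between the two half-lines\<close>
  have disj: "{z. ereal z \<le> x} \<inter> {p<..q} = {}"
  proof (intro equals0I)
    fix z assume "z \<in> {z. ereal z \<le> x} \<inter> {p<..q}"
    then have "ereal z \<le> x" "p < z" by auto
    then have "ereal z < ereal p" using p(1) by (meson order.strict_trans1)
    then show False using \<open>p < z\<close> by simp
  qed
  have sub: "{z. ereal z \<le> x} \<union> {p<..q} \<subseteq> {z. ereal z \<le> y}"
  proof (intro subsetI CollectI)
    fix z assume "z \<in> {z. ereal z \<le> x} \<union> {p<..q}"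
    then consider "ereal z \<le> x" | "ereal z \<le> ereal q" by auto
    then show "ereal z \<le> y"
      by cases (use \<open>x < y\<close> q(2) in \<open>meson less_imp_le order_trans\<close>)+
  qed
  have "Phi x < Phi x + measure (gauss 1) {p<..q}"
    using q by (simp add: measure_gauss_Ioc_pos)
  also have "\<dots> = measure (gauss 1) ({z. ereal z \<le> x} \<union> {p<..q})"
    unfolding Phi_def D using disj by (intro finite_measure_Union[symmetric]) auto
  also have "\<dots> \<le> Phi y"
    unfolding Phi_def D using sub by (intro finite_measure_mono) auto
  finally show "Phi x < Phi y" .
qed

lemma inj_Phi: "inj Phi" by (rule strict_mono_imp_inj_on[OF strict_mono_Phi])

lemma Phi_le_iff: "Phi x \<le> Phi y \<longleftrightarrow> x \<le> y" by (rule strict_mono_less_eq[OF strict_mono_Phi])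

lemma range_Phi: "range Phi = {0..1}"
proof -
  have "Phi x \<in> {0..1}" for x
    using Phi_le_iff[of x \<infinity>] Phi_le_iff[of "-\<infinity>" x] by simp
  moreover have "u \<in> range Phi" if u: "u \<in> {0..1}" for u
  proof -
    consider "u = 0" | "u = 1" | "0 < u" "u < 1" using u by force
    then show ?thesis
    proof cases
      case 3
      then obtain t where "cdf (gauss 1) t = u"
        using atomless_cdf_attains[OF real_distribution_gauss[of 1] measure_gauss_singleton[of 1], of u]
        by auto
      then show ?thesis by (metis Phi_ereal rangeI)
    qed (metis Phi_infinity rangeI)+
  qed
  ultimately show ?thesis by blast
qed

lemma borel_measurable_Phi [measurable]: "Phi \<in> borel_measurable borel"
proof -
  interpret real_distribution "gauss 1" by (rule real_distribution_gauss)
  have [measurable]: "cdf (gauss 1) \<in> borel_measurable borel"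
    by (intro borel_measurable_mono monoI cdf_nondecreasing)
  have "Phi = (\<lambda>x. if x = \<infinity> then 1 else if x = - \<infinity> then 0 else cdf (gauss 1) (real_of_ereal x))"
  proof
    fix x show "Phi x = (if x = \<infinity> then 1 else if x = - \<infinity> then 0 else cdf (gauss 1) (real_of_ereal x))"
      by (cases x) auto
  qed
  also have "\<dots> \<in> borel_measurable borel" by measurable
  finally show ?thesis .
qed

lemma borel_measurable_Phi_sc [measurable]: "Phi_sc \<sigma> \<rho> i \<in> borel_measurable borel"
  unfolding Phi_sc_def by measurable

lemma borel_measurable_inv_Phi: "inv_into UNIV Phi \<in> borel_measurable borel"
proof (rule borel_measurableI_le)
  fix y :: ereal
  define c where "c = (SOME x::ereal. False)"
  have "{u \<in> space borel. inv_into UNIV Phi u \<le> y} =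
      ({0..1} \<inter> {..Phi y}) \<union> (if c \<le> y then - {0..1} else {})"
  proof (rule Set.set_eqI)
    fix u
    show "u \<in> {u \<in> space borel. inv_into UNIV Phi u \<le> y} \<longleftrightarrow>
        u \<in> ({0..1} \<inter> {..Phi y}) \<union> (if c \<le> y then - {0..1} else {})"
    proof (cases "u \<in> {0..1}")
      case True
      then obtain x where "u = Phi x" using range_Phi by blast
      then show ?thesis using True by (simp add: inv_f_f[OF inj_Phi] Phi_le_iff)
    next
      case False
      then have "Phi x \<noteq> u" for x using range_Phi by blast
      then show ?thesis using False by (auto simp: inv_into_def c_def)
    qed
  qed
  then show "{u \<in> space borel. inv_into UNIV Phi u \<le> y} \<in> sets borel" by auto
qed

lemma ereal_divide_mult_cancel:
  fixes x :: ereal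
  assumes "r \<noteq> 0"
  shows "x / ereal r * ereal r = x" and "x * ereal r / ereal r = x"
proof -
  have "inverse (ereal r) * ereal r = 1" using assms by (simp add: one_ereal_def)
  then show "x / ereal r * ereal r = x" "x * ereal r / ereal r = x"
    by (metis divide_ereal_def mult.assoc mult.commute mult.right_neutral)+
qed

text \<open>
  The statistic has to be measurable everywhere, also where the path leaves the tuple and the scales
  are not under control. For a nonzero scale, the inverse is a rescaled inverse of \<open>Phi\<close> on $[0,1]$ and
  the default value of the choice operator elsewhere. For scale zero, \<open>Phi_sc\<close> has at most three values,
  so that its inverse differs from that default value at finitely many points only.
\<close>

lemma borel_measurable_inv_Phi_sc [measurable]: "inv_into UNIV (Phi_sc \<sigma> \<rho> j) \<in> borel_measurable borel"
proof (cases "\<sigma> * \<rho> j = 0")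
  case False
  define e where "e = ereal (\<sigma> * \<rho> j)"
  have e: "x / e * e = x" "x * e / e = x" for x
    using ereal_divide_mult_cancel[OF False] unfolding e_def by auto
  have "inv_into UNIV (Phi_sc \<sigma> \<rho> j) = (\<lambda>u. if u \<in> {0..1} then inv_into UNIV Phi u * e else (SOME x. False))"
  proof
    fix u
    show "inv_into UNIV (Phi_sc \<sigma> \<rho> j) u =
        (if u \<in> {0..1} then inv_into UNIV Phi u * e else (SOME x. False))"
    proof (cases "u \<in> {0..1}")
      case True
      then obtain x where x: "u = Phi x" using range_Phi by blast
      have "inj (Phi_sc \<sigma> \<rho> j)"
        by (rule injI) (metis Phi_sc_def e(1) e_def injD inj_Phi)
      moreover have "Phi_sc \<sigma> \<rho> j (x * e) = u" using x e by (simp add: Phi_sc_def e_def)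
      ultimately have "inv_into UNIV (Phi_sc \<sigma> \<rho> j) u = x * e" by (metis inv_f_f)
      then show ?thesis using True x by (simp add: inv_f_f[OF inj_Phi])
    next
      case False
      then have "Phi x \<noteq> u" for x using range_Phi by blast
      then have "(SOME y. Phi_sc \<sigma> \<rho> j y = u) = (SOME x. False)"
        by (simp add: Phi_sc_def)
      then show ?thesis unfolding if_not_P[OF False] inv_into_def by simp
    qed
  qed
  also have "\<dots> \<in> borel_measurable borel"
    using borel_measurable_inv_Phi by measurable
  finally show ?thesis .
next
  case True
  let ?h = "Phi_sc \<sigma> \<rho> j"
  have "?h x \<in> {Phi 0, Phi \<infinity>, Phi (- \<infinity>)}" for x
  proof -
    have "?h x = Phi (x * \<infinity>)" using True by (simp add: Phi_sc_def divide_ereal_def)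
    moreover have "x * \<infinity> \<in> {0, \<infinity>, - \<infinity>}"
      by (cases x "0::ereal" rule: linorder_cases) auto
    ultimately show ?thesis by auto
  qed
  then have fin: "finite (range ?h)" by (meson finite.emptyI finite.insertI finite_subset image_subsetI)
  define g where "g = inv_into UNIV ?h"
  have const: "g u = (SOME x. False)" if "u \<notin> range ?h" for u
  proof -
    have "?h x \<noteq> u" for x using that by blast
    then show ?thesis by (simp add: g_def inv_into_def)
  qed
  have "(\<lambda>u. if u \<in> range ?h then g u else (SOME x. False)) \<in> borel_measurable borel"
    by (rule measurable_discrete_difference[where f = "\<lambda>_. SOME x. False" and X = "range ?h"])
      (use fin in \<open>auto intro: countable_finite\<close>)
  moreover have "(\<lambda>u. if u \<in> range ?h then g u else (SOME x. False)) = g"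
    using const by auto
  ultimately show ?thesis unfolding g_def by simp
qed

lemma borel_measurable_P_tr [measurable]: "P_tr \<sigma> \<rho> i j \<in> borel_measurable borel"
  unfolding P_tr_def by measurable

lemma borel_measurable_interval_integral:
  fixes lo hi :: "'a \<Rightarrow> real" and h :: "'a \<Rightarrow> real \<Rightarrow> real"
  assumes [measurable]: "lo \<in> borel_measurable M" "hi \<in> borel_measurable M"
    "(\<lambda>(x, f). h x f) \<in> borel_measurable (M \<Otimes>\<^sub>M borel)"
  shows "(\<lambda>x. LBINT f=ereal (lo x)..ereal (hi x). h x f) \<in> borel_measurable M"
proof -
  have [measurable]: "(\<lambda>(x, f). h x f) \<in> borel_measurable (M \<Otimes>\<^sub>M lborel)"
    using assms(3) by (simp cong: measurable_cong_sets sets_pair_measure_cong)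
  have ind: "indicator (einterval (ereal u) (ereal v)) f = (if u < f \<and> f < v then 1 else 0 :: real)" for u v f
    by (auto simp: einterval_iff split: split_indicator)
  show ?thesis
    unfolding interval_lebesgue_integral_def set_lebesgue_integral_def ind by measurable
qed

lemma borel_measurable_I_int:
  "(\<lambda>(s, t). I_int \<sigma> \<rho> a b s t) \<in> borel_measurable (borel \<Otimes>\<^sub>M borel)"
proof (induction "b - a" arbitrary: a)
  case (0 a)
  then have "(\<lambda>(s, t). I_int \<sigma> \<rho> a b s t) = (\<lambda>_. 1)"
    by (subst I_int.simps) (auto simp: fun_eq_iff)
  then show ?case by simp
next
  case (Suc n a)
  show ?case
  proof (cases "b \<le> a + 1")
    case True
    then have "(\<lambda>(s, t). I_int \<sigma> \<rho> a b s t) = (\<lambda>_. 1)"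
    by (subst I_int.simps) (auto simp: fun_eq_iff)
    then show ?thesis by simp
  next
    case False
    have [measurable]: "(\<lambda>(s, t). I_int \<sigma> \<rho> (a + 1) b s t) \<in> borel_measurable (borel \<Otimes>\<^sub>M borel)"
      using Suc by simp
    have "(\<lambda>p. LBINT f=ereal (P_tr \<sigma> \<rho> (a + 1) b (snd p))..ereal (P_tr \<sigma> \<rho> (a + 1) a (fst p)).
             I_int \<sigma> \<rho> (a + 1) b f (snd p)) \<in> borel_measurable (borel \<Otimes>\<^sub>M borel)"
      by (intro borel_measurable_interval_integral) measurable
    moreover have "(\<lambda>(s, t). I_int \<sigma> \<rho> a b s t) =
        (\<lambda>p. LBINT f=ereal (P_tr \<sigma> \<rho> (a + 1) b (snd p))..ereal (P_tr \<sigma> \<rho> (a + 1) a (fst p)).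
             I_int \<sigma> \<rho> (a + 1) b f (snd p))"
      using False by (auto simp: fun_eq_iff I_int.simps[of \<sigma> \<rho> a b])
    ultimately show ?thesis by simp
  qed
qed

lemma borel_measurable_I_int_compose [measurable (raw)]:
  assumes "f \<in> borel_measurable M" "g \<in> borel_measurable M"
  shows "(\<lambda>x. I_int \<sigma> \<rho> a b (f x) (g x)) \<in> borel_measurable M"
  using measurable_compose[OF measurable_Pair[OF assms] borel_measurable_I_int] by simp


section \<open>Descending Gaussian vectors and the iterated integrals\<close>

definition descends :: "nat \<Rightarrow> nat \<Rightarrow> (nat \<Rightarrow> ereal) \<Rightarrow> bool" where
  "descends a b u \<longleftrightarrow> (\<forall>i\<in>{a..<b}. u (Suc i) < u i)"

text \<open>
  The two ends of the chain keep their knots, of which the first may be infinite; the redrawn values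
  in between are real.
\<close>

definition fill :: "nat \<Rightarrow> nat \<Rightarrow> (nat \<Rightarrow> ereal) \<Rightarrow> (nat \<Rightarrow> real) \<Rightarrow> nat \<Rightarrow> ereal" where
  "fill a b lam s i = (if a < i \<and> i < b then ereal (s i) else lam i)"

lemma descends_cong:
  assumes "\<And>i. a \<le> i \<Longrightarrow> i \<le> b \<Longrightarrow> u i = v i"
  shows "descends a b u = descends a b v"
  using assms by (simp add: descends_def)

lemma descends_split: "a \<le> b \<Longrightarrow> b \<le> c \<Longrightarrow> descends a c u \<longleftrightarrow> descends a b u \<and> descends b c u"
  by (auto simp: descends_def ball_Un simp flip: ivl_disj_un_two(3)[of a b c])

lemma descends_Suc: "descends a (Suc a) u \<longleftrightarrow> u (Suc a) < u a"
  by (simp add: descends_def)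

lemma descends_less: "descends a b u \<Longrightarrow> a < b \<Longrightarrow> u b < u a"
proof (induction b)
  case (Suc b)
  then show ?case using descends_split[of a b "Suc b" u]
    by (cases "a = b") (auto simp: descends_Suc intro: less_trans)
qed simp

lemma pred_descends [measurable (raw)]:
  assumes [measurable]: "\<And>i. (\<lambda>x. u x i) \<in> borel_measurable M"
  shows "Measurable.pred M (\<lambda>x. descends a b (u x))"
  unfolding descends_def by measurable

lemma borel_measurable_fill [measurable (raw)]:
  assumes [measurable]: "\<And>i. (\<lambda>x. lam x i) \<in> borel_measurable M"
    and s [measurable]: "s \<in> measurable M (PiM {a<..<b} (\<lambda>i. gauss (\<tau> i)))"
  shows "(\<lambda>x. fill a b (lam x) (s x) i) \<in> borel_measurable M"
proof (cases "i \<in> {a<..<b}")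
  case True
  have "(\<lambda>x. s x i) \<in> measurable M (gauss (\<tau> i))"
    using measurable_compose[OF s measurable_component_singleton[OF True]] .
  then have [measurable]: "(\<lambda>x. s x i) \<in> borel_measurable M"
    by (simp cong: measurable_cong_sets)
  show ?thesis using True by (simp add: fill_def)
next
  case False
  then have "(\<lambda>x. fill a b (lam x) (s x) i) = (\<lambda>x. lam x i)" by (auto simp: fill_def)
  then show ?thesis by simp
qed

locale gauss_product =
  fixes \<tau> :: "nat \<Rightarrow> real"
begin

sublocale product_prob_space "\<lambda>i. gauss (\<tau> i)" UNIV
  by (intro product_prob_space.intro product_prob_space_axioms.intro product_sigma_finite.intro
      prob_space_imp_sigma_finite prob_space_gauss)

abbreviation G :: "nat \<Rightarrow> nat \<Rightarrow> (nat \<Rightarrow> real) measure" where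
  "G a b \<equiv> PiM {a<..<b} (\<lambda>i. gauss (\<tau> i))"

lemma prob_space_G: "prob_space (G a b)"
  by (intro prob_space_PiM prob_space_gauss)

text \<open>
  This is the iterated integral \<open>I_int\<close> in the original coordinates, before the distribution functions
  are applied.
\<close>

definition chain_prob :: "nat \<Rightarrow> nat \<Rightarrow> (nat \<Rightarrow> ereal) \<Rightarrow> real" where
  "chain_prob a b lam = measure (G a b) {s \<in> space (G a b). descends a b (fill a b lam s)}"

lemma chain_prob_eq_nn_integral:
  "ennreal (chain_prob a b lam) = (\<integral>\<^sup>+s. indicator {s. descends a b (fill a b lam s)} s \<partial>G a b)"
proof -
  interpret G: prob_space "G a b" by (rule prob_space_G)
  have "(\<integral>\<^sup>+s. indicator {s. descends a b (fill a b lam s)} s \<partial>G a b) =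
      (\<integral>\<^sup>+s. indicator {s \<in> space (G a b). descends a b (fill a b lam s)} s \<partial>G a b)"
    by (intro nn_integral_cong) (simp add: indicator_def)
  also have "\<dots> = emeasure (G a b) {s \<in> space (G a b). descends a b (fill a b lam s)}"
    by (intro nn_integral_indicator) measurable
  finally show ?thesis by (simp add: chain_prob_def G.emeasure_eq_measure)
qed

lemma borel_measurable_chain_prob [measurable (raw)]:
  assumes "\<And>i. (\<lambda>x. lam x i) \<in> borel_measurable M"
  shows "(\<lambda>x. chain_prob a b (lam x)) \<in> borel_measurable M"
proof -
  interpret G: prob_space "G a b" by (rule prob_space_G)
  have [measurable]: "(\<lambda>p. lam (fst p) i) \<in> borel_measurable (M \<Otimes>\<^sub>M G a b)" for i
    using measurable_compose[OF measurable_fst assms] .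
  have "chain_prob a b (lam x) =
      enn2real (\<integral>\<^sup>+s. indicator {p. descends a b (fill a b (lam (fst p)) (snd p))} (x, s) \<partial>G a b)" for x
  proof -
    have "chain_prob a b (lam x) = enn2real (ennreal (chain_prob a b (lam x)))"
      by (simp add: chain_prob_def)
    then show ?thesis unfolding chain_prob_eq_nn_integral
      by (auto simp: indicator_def intro!: arg_cong[where f = enn2real] nn_integral_cong)
  qed
  then have eq: "(\<lambda>x. chain_prob a b (lam x)) = (\<lambda>x.
      enn2real (\<integral>\<^sup>+s. indicator {p. descends a b (fill a b (lam (fst p)) (snd p))} (x, s) \<partial>G a b))"
    by blast
  show ?thesis unfolding eq by measurable
qed

text \<open>
  Once the value \<open>v\<close> at position \<open>b\<close> is given, the values before and after \<open>b\<close> are independent, and the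
  two parts of the chain interact only through \<open>v\<close>.
\<close>

lemma measure_chain_split:
  assumes ab: "a < b" "b < c" and [measurable]: "Measurable.pred borel P"
  shows "measure (G a c) {s \<in> space (G a c). descends a c (fill a c lam s) \<and> P (s b)} =
    (\<integral>v. indicator (Collect P) v * (chain_prob a b (lam(b := ereal v)) * chain_prob b c (lam(b := ereal v)))
      \<partial>gauss (\<tau> b))"
proof -
  let ?I = "{a<..<b}" and ?J = "{b<..<c}"
  have I: "{a<..<c} = insert b (?I \<union> ?J)" "b \<notin> ?I \<union> ?J" "?I \<inter> ?J = {}" using ab by auto
  have b_comp [measurable]: "(\<lambda>s. s b) \<in> borel_measurable (G a c)"
    using measurable_component_singleton[of b "{a<..<c}" "\<lambda>i. gauss (\<tau> i)"] ab
    by (simp cong: measurable_cong_sets)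
  let ?E = "{s. descends a c (fill a c lam s) \<and> P (s b)}"
  let ?f = "\<lambda>s. indicator ?E s :: ennreal"
  have [measurable]: "?f \<in> borel_measurable (G a c)"
    by (intro borel_measurable_indicator') measurable
  have D [measurable]: "(\<lambda>s. indicator {s. descends a' b' (fill a' b' (lam(b := ereal v)) s)} s :: ennreal)
      \<in> borel_measurable (G a' b')" for v a' b'
    by (intro borel_measurable_indicator') measurable
  have split: "?f ((merge ?I ?J (x, y))(b := v)) =
      indicator (Collect P) v * (indicator {s. descends a b (fill a b (lam(b := ereal v)) s)} x *
        indicator {s. descends b c (fill b c (lam(b := ereal v)) s)} y)" for x y v
  proof -
    let ?s = "(merge ?I ?J (x, y))(b := v)"
    have "descends a b (fill a c lam ?s) = descends a b (fill a b (lam(b := ereal v)) x)"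
      using ab by (intro descends_cong) (auto simp: fill_def merge_def)
    moreover have "descends b c (fill a c lam ?s) = descends b c (fill b c (lam(b := ereal v)) y)"
      using ab by (intro descends_cong) (auto simp: fill_def merge_def)
    ultimately show ?thesis
      using descends_split[of a b c "fill a c lam ?s"] ab by (auto simp: indicator_def)
  qed
  have "emeasure (G a c) {s \<in> space (G a c). descends a c (fill a c lam s) \<and> P (s b)} = (\<integral>\<^sup>+s. ?f s \<partial>G a c)"
    by (subst nn_integral_indicator[symmetric], measurable, intro nn_integral_cong) (simp add: indicator_def)
  also have "\<dots> = (\<integral>\<^sup>+v. \<integral>\<^sup>+s. ?f (s(b := v)) \<partial>PiM (?I \<union> ?J) (\<lambda>i. gauss (\<tau> i)) \<partial>gauss (\<tau> b))"
    unfolding I(1) by (rule product_nn_integral_insert_rev) (use I in \<open>auto simp flip: I(1)\<close>)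
  also have "\<dots> = (\<integral>\<^sup>+v. ennreal (indicator (Collect P) v *
      (chain_prob a b (lam(b := ereal v)) * chain_prob b c (lam(b := ereal v)))) \<partial>gauss (\<tau> b))"
  proof (rule nn_integral_cong)
    fix v
    have [measurable]: "(\<lambda>s. s(b := v)) \<in> measurable (PiM (?I \<union> ?J) (\<lambda>i. gauss (\<tau> i))) (G a c)"
      unfolding I(1) by (intro measurable_fun_upd[where J = "?I \<union> ?J"]) auto
    have "(\<integral>\<^sup>+s. ?f (s(b := v)) \<partial>PiM (?I \<union> ?J) (\<lambda>i. gauss (\<tau> i))) =
        (\<integral>\<^sup>+x. \<integral>\<^sup>+y. ?f ((merge ?I ?J (x, y))(b := v)) \<partial>G b c \<partial>G a b)"
      by (rule product_nn_integral_fold) (use I in auto)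
    also have "\<dots> = indicator (Collect P) v *
        (ennreal (chain_prob a b (lam(b := ereal v))) * ennreal (chain_prob b c (lam(b := ereal v))))"
      unfolding split chain_prob_eq_nn_integral
      by (simp add: nn_integral_cmult nn_integral_multc)
    finally show "(\<integral>\<^sup>+s. ?f (s(b := v)) \<partial>PiM (?I \<union> ?J) (\<lambda>i. gauss (\<tau> i))) =
        ennreal (indicator (Collect P) v *
          (chain_prob a b (lam(b := ereal v)) * chain_prob b c (lam(b := ereal v))))"
      by (simp add: chain_prob_def ennreal_mult indicator_def)
  qed
  finally have eq: "emeasure (G a c) {s \<in> space (G a c). descends a c (fill a c lam s) \<and> P (s b)} = \<dots>" .
  have Pset: "Collect P \<in> sets borel" using assms(3) by simp
  have cp: "(\<lambda>v. chain_prob a' b' (lam(b := ereal v))) \<in> borel_measurable borel" for a' b'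
  proof (rule borel_measurable_chain_prob)
    show "(\<lambda>v. (lam(b := ereal v)) i) \<in> borel_measurable borel" for i
      by (cases "i = b") auto
  qed
  have "(\<integral>v. indicator (Collect P) v * (chain_prob a b (lam(b := ereal v)) * chain_prob b c (lam(b := ereal v)))
      \<partial>gauss (\<tau> b)) = enn2real (\<integral>\<^sup>+v. ennreal (indicator (Collect P) v *
      (chain_prob a b (lam(b := ereal v)) * chain_prob b c (lam(b := ereal v)))) \<partial>gauss (\<tau> b))"
  proof (rule integral_eq_nn_integral)
    show "(\<lambda>v. indicator (Collect P) v * (chain_prob a b (lam(b := ereal v)) * chain_prob b c (lam(b := ereal v))))
        \<in> borel_measurable (gauss (\<tau> b))"
      using Pset cp by (simp cong: measurable_cong_sets)
  qed (simp add: chain_prob_def)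
  then show ?thesis unfolding eq[symmetric] by (simp add: measure_def)
qed

lemma chain_prob_Suc: "chain_prob a (Suc a) lam = (if lam (Suc a) < lam a then 1 else 0)"
proof -
  interpret G: prob_space "G a (Suc a)" by (rule prob_space_G)
  have "fill a (Suc a) lam s = lam" for s by (auto simp: fill_def fun_eq_iff)
  then show ?thesis by (simp add: chain_prob_def descends_Suc G.prob_space)
qed

lemma chain_prob_eq_0: "a < b \<Longrightarrow> \<not> lam b < lam a \<Longrightarrow> chain_prob a b lam = 0"
proof -
  assume "a < b" "\<not> lam b < lam a"
  then have "\<not> descends a b (fill a b lam s)" for s
    using descends_less[of a b "fill a b lam s"] by (auto simp: fill_def)
  then show ?thesis by (simp add: chain_prob_def)
qed

end

lemma Phi_sc_strict_mono:
  assumes "\<sigma> * \<rho> i > 0" shows "Phi_sc \<sigma> \<rho> i x < Phi_sc \<sigma> \<rho> i y \<longleftrightarrow> x < y"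
proof -
  have "x / ereal (\<sigma> * \<rho> i) < y / ereal (\<sigma> * \<rho> i) \<longleftrightarrow> x < y"
    using ereal_divide_less_iff[of "ereal (\<sigma> * \<rho> i)" x "y / ereal (\<sigma> * \<rho> i)"] assms
      ereal_divide_mult_cancel(1)[OF less_imp_neq[OF assms, symmetric], of y]
    by (metis ereal_less(2) less_ereal.simps(4))
  then show ?thesis unfolding Phi_sc_def by (simp add: strict_mono_less[OF strict_mono_Phi])
qed

lemma inj_Phi_sc:
  assumes "\<sigma> * \<rho> i > 0" shows "inj (Phi_sc \<sigma> \<rho> i)"
  by (rule injI) (metis Phi_sc_strict_mono[of \<sigma> \<rho> i, OF assms] less_irrefl linorder_neqE)

lemma P_tr_Phi_sc:
  assumes "\<sigma> * \<rho> j > 0" "j \<noteq> 0" shows "P_tr \<sigma> \<rho> i j (Phi_sc \<sigma> \<rho> j x) = Phi_sc \<sigma> \<rho> i x"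
  using assms by (simp add: P_tr_def inv_f_f[OF inj_Phi_sc])

lemma Phi_sc_infinity: "\<sigma> * \<rho> i > 0 \<Longrightarrow> Phi_sc \<sigma> \<rho> i \<infinity> = 1"
  by (simp add: Phi_sc_def)

lemma Phi_sc_ereal:
  assumes "\<sigma> * \<rho> i > 0" shows "Phi_sc \<sigma> \<rho> i (ereal x) = cdf (gauss (\<sigma> * \<rho> i)) x"
proof -
  let ?\<tau> = "\<sigma> * \<rho> i"
  have "{z. ?\<tau> * z \<le> x} = {z. z \<le> x / ?\<tau>}" using assms by (auto simp: pos_le_divide_eq mult.commute)
  then have "cdf (gauss ?\<tau>) x = measure std_normal_distribution {z. z \<le> x / ?\<tau>}"
    unfolding cdf_def gauss_def by (subst measure_distr) (auto simp: vimage_def)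
  then show ?thesis using assms by (auto simp: Phi_sc_def Phi_def)
qed

lemma distr_Phi_sc:
  assumes "\<sigma> * \<rho> i > 0"
  shows "distr (gauss (\<sigma> * \<rho> i)) borel (\<lambda>x. Phi_sc \<sigma> \<rho> i (ereal x)) = unif"
  using prob_integral_transform[OF real_distribution_gauss measure_gauss_singleton[OF assms]]
  by (simp add: Phi_sc_ereal[of \<sigma> \<rho> i, OF assms])

text \<open>
  The substitution $f = \Phi_i(v)$: the probability integral transform of the normal law with standard
  deviation $\sigma\rho_i$ is the uniform law on $(0,1)$, an interval that contains the range of
  integration.
\<close>

lemma interval_integral_Phi_sc:
  fixes h :: "real \<Rightarrow> real"
  assumes pos: "\<sigma> * \<rho> i > 0" and "z \<le> x" and h [measurable]: "h \<in> borel_measurable borel"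
  shows "(LBINT f=ereal (Phi_sc \<sigma> \<rho> i z)..ereal (Phi_sc \<sigma> \<rho> i x). h f) =
    (\<integral>v. indicator {v. z < ereal v \<and> ereal v < x} v * h (Phi_sc \<sigma> \<rho> i (ereal v)) \<partial>gauss (\<sigma> * \<rho> i))"
proof -
  let ?P = "Phi_sc \<sigma> \<rho> i"
  have le: "?P z \<le> ?P x" using Phi_sc_strict_mono[of \<sigma> \<rho> i x z] pos assms(2) by (simp add: not_less[symmetric])
  have in01: "?P y \<in> {0..1}" for y
    using range_Phi unfolding Phi_sc_def by blast
  have sub: "{?P z<..<?P x} \<inter> {0<..<1} = {?P z<..<?P x}"
    using in01[of z] in01[of x] by auto
  have unif_density: "unif = density lborel (\<lambda>x. ennreal (indicator {0<..<1} x))"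
    by (simp add: uniform_measure_def ennreal_indicator divide_ennreal_def)
  have "(LBINT f=ereal (?P z)..ereal (?P x). h f) = (\<integral>f. indicator {?P z<..<?P x} f * h f \<partial>lborel)"
    using le by (simp add: interval_lebesgue_integral_def set_lebesgue_integral_def)
  also have "\<dots> = (\<integral>f. indicator {0<..<1} f * (indicator {?P z<..<?P x} f * h f) \<partial>lborel)"
  proof (rule Bochner_Integration.integral_cong[OF refl])
    fix f
    have "indicator {?P z<..<?P x} f = indicator {0<..<1} f * (indicator {?P z<..<?P x} f :: real)"
      using sub by (metis Int_commute indicator_inter_arith)
    then show "indicator {?P z<..<?P x} f * h f = indicator {0<..<1} f * (indicator {?P z<..<?P x} f * h f)"
      by (metis mult.assoc)
  qed
  also have "\<dots> = (\<integral>f. indicator {?P z<..<?P x} f * h f \<partial>unif)"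
    unfolding unif_density by (subst integral_real_density) auto
  also have "\<dots> = (\<integral>v. indicator {?P z<..<?P x} (?P (ereal v)) * h (?P (ereal v)) \<partial>gauss (\<sigma> * \<rho> i))"
    unfolding distr_Phi_sc[of \<sigma> \<rho> i, OF pos, symmetric] by (rule integral_distr) measurable
  finally show ?thesis
    by (simp add: indicator_def Phi_sc_strict_mono[of \<sigma> \<rho> i] pos)
qed

locale scaled_chain = gauss_product "\<lambda>i. \<sigma> * \<rho> i" for \<sigma> :: real and \<rho> :: "nat \<Rightarrow> real"
begin

text \<open>
  The outermost integral of \<open>I_int\<close> runs over the first value of the chain. After substitution it is
  \<open>measure_chain_split\<close> at \<open>Suc a\<close>, where the part before is just the condition that the first value
  is less than \<open>lam a\<close>. A first value not above \<open>lam b\<close> contributes nothing to the split, in agreement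
  with the lower limit of the integral.
\<close>

lemma I_int_eq_chain_prob:
  assumes "a < b" and "lam b < lam a" and "\<And>i. a \<le> i \<Longrightarrow> i \<le> b \<Longrightarrow> i \<noteq> 0 \<Longrightarrow> \<sigma> * \<rho> i > 0"
    and "a = 0 \<Longrightarrow> lam a = \<infinity>"
  shows "I_int \<sigma> \<rho> a b (F_val \<sigma> \<rho> lam a) (F_val \<sigma> \<rho> lam b) = chain_prob a b lam"
  using assms
proof (induction "b - a" arbitrary: a lam)
  case (Suc n a lam)
  note pos = Suc.prems(3)
  show ?case
  proof (cases "b = Suc a")
    case True
    then show ?thesis using Suc.prems by (simp add: I_int.simps chain_prob_Suc)
  next
    case False
    then have b: "Suc a < b" using Suc by simp
    let ?P = "Phi_sc \<sigma> \<rho> (Suc a)" and ?t = "F_val \<sigma> \<rho> lam b"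
    have pos1: "\<sigma> * \<rho> (Suc a) > 0" using pos b by simp
    have lower: "P_tr \<sigma> \<rho> (Suc a) b ?t = ?P (lam b)"
      using pos[of b] b by (simp add: F_val_def P_tr_Phi_sc)
    have upper: "P_tr \<sigma> \<rho> (Suc a) a (F_val \<sigma> \<rho> lam a) = ?P (lam a)"
    proof (cases "a = 0")
      case True
      then show ?thesis using Suc.prems(4) pos1 by (simp add: P_tr_def Phi_sc_infinity)
    next
      case False
      then show ?thesis using P_tr_Phi_sc[of \<sigma> \<rho> a "Suc a" "lam a"] pos[of a] b by (simp add: F_val_def)
    qed
    have "I_int \<sigma> \<rho> a b (F_val \<sigma> \<rho> lam a) ?t =
        (LBINT f=ereal (?P (lam b))..ereal (?P (lam a)). I_int \<sigma> \<rho> (Suc a) b f ?t)"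
      using b by (subst I_int.simps) (simp add: lower upper)
    also have "\<dots> = (\<integral>v. indicator {v. lam b < ereal v \<and> ereal v < lam a} v *
        I_int \<sigma> \<rho> (Suc a) b (?P (ereal v)) ?t \<partial>gauss (\<sigma> * \<rho> (Suc a)))"
      using Suc.prems(2) pos1 by (intro interval_integral_Phi_sc) auto
    also have "\<dots> = (\<integral>v. indicator (Collect (\<lambda>_. True)) v *
        (chain_prob a (Suc a) (lam(Suc a := ereal v)) * chain_prob (Suc a) b (lam(Suc a := ereal v)))
        \<partial>gauss (\<sigma> * \<rho> (Suc a)))"
    proof (rule Bochner_Integration.integral_cong[OF refl])
      fix v
      let ?lam = "lam(Suc a := ereal v)"
      show "indicator {v. lam b < ereal v \<and> ereal v < lam a} v * I_int \<sigma> \<rho> (Suc a) b (?P (ereal v)) ?t =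
          indicator (Collect (\<lambda>_. True)) v * (chain_prob a (Suc a) ?lam * chain_prob (Suc a) b ?lam)"
      proof (cases "lam b < ereal v")
        case True
        have "I_int \<sigma> \<rho> (Suc a) b (F_val \<sigma> \<rho> ?lam (Suc a)) (F_val \<sigma> \<rho> ?lam b) = chain_prob (Suc a) b ?lam"
          using Suc.hyps(2) b True pos by (intro Suc.hyps(1)) auto
        then have "I_int \<sigma> \<rho> (Suc a) b (?P (ereal v)) ?t = chain_prob (Suc a) b ?lam"
          using b by (simp add: F_val_def)
        then show ?thesis using True by (simp add: chain_prob_Suc indicator_def)
      next
        case False
        then show ?thesis using b by (simp add: chain_prob_eq_0)
      qed
    qed
    also have "\<dots> = chain_prob a b lam"
      using b by (subst measure_chain_split[symmetric]) (auto simp: chain_prob_def)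
    finally show ?thesis .
  qed
qed simp

text \<open>
  The integrand of \<open>F_abc\<close> consists of the two halves of the chain on either side of position \<open>b\<close>.
\<close>

lemma F_abc_eq_chain_measure:
  assumes "a < b" "b < c" and "lam c \<le> t" "t \<le> lam a"
    and pos: "\<And>i. a \<le> i \<Longrightarrow> i \<le> c \<Longrightarrow> i \<noteq> 0 \<Longrightarrow> \<sigma> * \<rho> i > 0" and "a = 0 \<Longrightarrow> lam a = \<infinity>"
  shows "F_abc \<sigma> \<rho> lam a b c t =
    measure (G a c) {s \<in> space (G a c). descends a c (fill a c lam s) \<and> ereal (s b) < t}"
proof -
  have posb: "\<sigma> * \<rho> b > 0" using pos[of b] assms by simp
  have "F_abc \<sigma> \<rho> lam a b c t = (LBINT f=ereal (Phi_sc \<sigma> \<rho> b (lam c))..ereal (Phi_sc \<sigma> \<rho> b t).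
      I_int \<sigma> \<rho> a b (F_val \<sigma> \<rho> lam a) f * I_int \<sigma> \<rho> b c f (F_val \<sigma> \<rho> lam c))"
    using assms by (simp add: F_abc_def)
  also have "\<dots> = (\<integral>v. indicator {v. lam c < ereal v \<and> ereal v < t} v *
      (I_int \<sigma> \<rho> a b (F_val \<sigma> \<rho> lam a) (Phi_sc \<sigma> \<rho> b (ereal v)) *
       I_int \<sigma> \<rho> b c (Phi_sc \<sigma> \<rho> b (ereal v)) (F_val \<sigma> \<rho> lam c)) \<partial>gauss (\<sigma> * \<rho> b))"
    using posb assms(3) by (intro interval_integral_Phi_sc) auto
  also have "\<dots> = (\<integral>v. indicator (Collect (\<lambda>v. ereal v < t)) v *
      (chain_prob a b (lam(b := ereal v)) * chain_prob b c (lam(b := ereal v))) \<partial>gauss (\<sigma> * \<rho> b))"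
  proof (rule Bochner_Integration.integral_cong[OF refl])
    fix v
    let ?lam = "lam(b := ereal v)"
    have Fb: "F_val \<sigma> \<rho> ?lam b = Phi_sc \<sigma> \<rho> b (ereal v)" "F_val \<sigma> \<rho> ?lam a = F_val \<sigma> \<rho> lam a"
      "F_val \<sigma> \<rho> ?lam c = F_val \<sigma> \<rho> lam c"
      using assms by (auto simp: F_val_def)
    show "indicator {v. lam c < ereal v \<and> ereal v < t} v *
        (I_int \<sigma> \<rho> a b (F_val \<sigma> \<rho> lam a) (Phi_sc \<sigma> \<rho> b (ereal v)) *
         I_int \<sigma> \<rho> b c (Phi_sc \<sigma> \<rho> b (ereal v)) (F_val \<sigma> \<rho> lam c)) =
        indicator (Collect (\<lambda>v. ereal v < t)) v * (chain_prob a b ?lam * chain_prob b c ?lam)"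
    proof (cases "lam c < ereal v \<and> ereal v < t")
      case True
      have "I_int \<sigma> \<rho> a b (F_val \<sigma> \<rho> ?lam a) (F_val \<sigma> \<rho> ?lam b) = chain_prob a b ?lam"
        using assms True by (intro I_int_eq_chain_prob) auto
      moreover have "I_int \<sigma> \<rho> b c (F_val \<sigma> \<rho> ?lam b) (F_val \<sigma> \<rho> ?lam c) = chain_prob b c ?lam"
        using assms True by (intro I_int_eq_chain_prob) auto
      ultimately show ?thesis using True unfolding Fb by simp
    next
      case False
      then have "\<not> ereal v < t \<or> chain_prob b c ?lam = 0"
        using assms by (auto intro!: chain_prob_eq_0)
      then show ?thesis using False by (auto simp: indicator_def)
    qed
  qed
  also have "\<dots> = measure (G a c) {s \<in> space (G a c). descends a c (fill a c lam s) \<and> ereal (s b) < t}"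
    using assms by (intro measure_chain_split[symmetric]) auto
  finally show ?thesis .
qed

text \<open>
  On the chain, numerator and denominator of the statistic are the measures of the parts of the chain
  with \<open>b\<close>-th value below \<open>s b\<close> and below \<open>lam a\<close>; the latter is the whole chain.
\<close>

lemma alpha_uniform_on_chain:
  fixes lam :: "nat \<Rightarrow> ereal"
  assumes "a < b" "b < c"
    and pos: "\<And>i. a \<le> i \<Longrightarrow> i \<le> c \<Longrightarrow> i \<noteq> 0 \<Longrightarrow> \<sigma> * \<rho> i > 0" and a0: "a = 0 \<Longrightarrow> lam a = \<infinity>"
    and B: "B \<in> sets borel"
  shows "emeasure (G a c) {s \<in> space (G a c). descends a c (fill a c lam s) \<and>
      1 - F_abc \<sigma> \<rho> lam a b c (ereal (s b)) / F_abc \<sigma> \<rho> lam a b c (lam a) \<in> B} =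
    emeasure (G a c) {s \<in> space (G a c). descends a c (fill a c lam s)} * emeasure unif B"
proof -
  let ?S = "{s \<in> space (G a c). descends a c (fill a c lam s)}"
  have b_comp [measurable]: "(\<lambda>s. s b) \<in> borel_measurable (G a c)"
    using measurable_component_singleton[of b "{a<..<c}" "\<lambda>i. gauss (\<sigma> * \<rho> i)"] assms
    by (simp cong: measurable_cong_sets)
  have S: "?S \<in> sets (G a c)" by measurable
  have between: "lam c < ereal (s b)" "ereal (s b) < lam a" if "s \<in> ?S" for s
  proof -
    have "descends a b (fill a c lam s)" "descends b c (fill a c lam s)"
      using that descends_split[of a b c "fill a c lam s"] assms by auto
    then have "fill a c lam s b < fill a c lam s a" "fill a c lam s c < fill a c lam s b"
      using descends_less assms by blast+
    then show "lam c < ereal (s b)" "ereal (s b) < lam a" using assms by (auto simp: fill_def)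
  qed
  have H: "F_abc \<sigma> \<rho> lam a b c (ereal (s b)) = measure (G a c) {r \<in> ?S. r b < s b}"
    "F_abc \<sigma> \<rho> lam a b c (lam a) = measure (G a c) ?S" if "s \<in> ?S" for s
  proof -
    have "F_abc \<sigma> \<rho> lam a b c (ereal (s b)) =
        measure (G a c) {r \<in> space (G a c). descends a c (fill a c lam r) \<and> ereal (r b) < ereal (s b)}"
      using between[OF that] assms by (intro F_abc_eq_chain_measure) auto
    then show "F_abc \<sigma> \<rho> lam a b c (ereal (s b)) = measure (G a c) {r \<in> ?S. r b < s b}"
      by (simp add: conj_assoc)
    have "F_abc \<sigma> \<rho> lam a b c (lam a) =
        measure (G a c) {r \<in> space (G a c). descends a c (fill a c lam r) \<and> ereal (r b) < lam a}"
      using less_trans[OF between[OF that]] assms by (intro F_abc_eq_chain_measure) auto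
    also have "{r \<in> space (G a c). descends a c (fill a c lam r) \<and> ereal (r b) < lam a} = ?S"
      using between(2) by auto
    finally show "F_abc \<sigma> \<rho> lam a b c (lam a) = measure (G a c) ?S" .
  qed
  have "{s \<in> space (G a c). descends a c (fill a c lam s) \<and>
      1 - F_abc \<sigma> \<rho> lam a b c (ereal (s b)) / F_abc \<sigma> \<rho> lam a b c (lam a) \<in> B} =
      {s \<in> ?S. 1 - measure (G a c) {r \<in> ?S. r b < s b} / measure (G a c) ?S \<in> B}"
    using H by auto
  moreover have "emeasure (G a c) {s \<in> ?S. 1 - measure (G a c) {r \<in> ?S. r b < s b} / measure (G a c) ?S \<in> B} =
      emeasure (G a c) ?S * emeasure unif B"
  proof (rule conditional_survival_uniform[OF prob_space_G S b_comp _ B])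
    fix x
    have "distr (G a c) (gauss (\<sigma> * \<rho> b)) (\<lambda>s. s b) = gauss (\<sigma> * \<rho> b)"
      using assms by (intro distr_PiM_component prob_space_gauss) auto
    moreover have "(\<lambda>s. s b) \<in> measurable (G a c) (gauss (\<sigma> * \<rho> b))"
      using assms by (intro measurable_component_singleton) auto
    ultimately have "measure (gauss (\<sigma> * \<rho> b)) {x} = measure (G a c) ((\<lambda>s. s b) -` {x} \<inter> space (G a c))"
      using measure_distr[of "\<lambda>s. s b" "G a c" "gauss (\<sigma> * \<rho> b)" "{x}"] by simp
    then show "measure (G a c) {s \<in> space (G a c). s b = x} = 0"
      using measure_gauss_singleton[of "\<sigma> * \<rho> b" x] pos[of b] assms by (simp add: vimage_def Int_def conj_commute)
  qed
  ultimately show ?thesis by simp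
qed

end


section \<open>Regression on signed columns\<close>

text \<open>
  With signs attached to the columns, $R$ is a Gram matrix and $Z_i$ is an inner product.
\<close>

definition signed_column :: "real^'p^'n \<Rightarrow> 'p + 'p \<Rightarrow> real^'n" where
  "signed_column X i = sign_of i *\<^sub>R column (var_of i) X"

lemma R_mat_eq_inner: "R_mat X i j = signed_column X i \<bullet> signed_column X j"
  by (simp add: R_mat_def signed_column_def matrix_matrix_mult_def
      Finite_Cartesian_Product.transpose_def column_def inner_vec_def
      sum_distrib_left mult_ac)

lemma Z_vec_eq_inner: "Z_vec X y i = signed_column X i \<bullet> y"
  by (simp add: Z_vec_def signed_column_def matrix_vector_mult_def
      Finite_Cartesian_Product.transpose_def column_def inner_vec_def
      sum_distrib_left mult_ac)

lemma span_image_list: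
  fixes f :: "'i \<Rightarrow> 'v::real_vector"
  assumes "P \<in> span (f ` set L)"
  obtains c where "P = (\<Sum>k<length L. c k *\<^sub>R f (L ! k))"
proof -
  let ?S = "{\<Sum>k<length L. c k *\<^sub>R f (L ! k) | c. True}"
  have "subspace ?S"
  proof (rule subspaceI)
    show "0 \<in> ?S" by (rule CollectI, rule exI[of _ "\<lambda>_. 0"]) simp
  next
    fix u v assume "u \<in> ?S" "v \<in> ?S"
    then obtain c d where "u = (\<Sum>k<length L. c k *\<^sub>R f (L ! k))" "v = (\<Sum>k<length L. d k *\<^sub>R f (L ! k))"
      by auto
    then have "u + v = (\<Sum>k<length L. (c k + d k) *\<^sub>R f (L ! k))"
      by (simp add: scaleR_left_distrib sum.distrib)
    then show "u + v \<in> ?S" by (intro CollectI exI[of _ "\<lambda>k. c k + d k"]) simp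
  next
    fix r u assume "u \<in> ?S"
    then obtain c where "u = (\<Sum>k<length L. c k *\<^sub>R f (L ! k))" by auto
    then have "r *\<^sub>R u = (\<Sum>k<length L. (r * c k) *\<^sub>R f (L ! k))"
      by (simp add: scaleR_right.sum)
    then show "r *\<^sub>R u \<in> ?S" by (intro CollectI exI[of _ "\<lambda>k. r * c k"]) simp
  qed
  moreover have "f ` set L \<subseteq> ?S"
  proof clarify
    fix i assume "i \<in> set L"
    then obtain k where k: "k < length L" "i = L ! k" by (metis in_set_conv_nth)
    have "f i = (\<Sum>l<length L. (if l = k then 1 else 0) *\<^sub>R f (L ! l))"
      using k by (simp add: if_distrib[of "\<lambda>r. r *\<^sub>R _"] sum.delta' cong: if_cong)
    then show "\<exists>c. f i = (\<Sum>k<length L. c k *\<^sub>R f (L ! k)) \<and> True"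
      by (intro exI[of _ "\<lambda>l. if l = k then 1 else 0"]) simp
  qed
  ultimately have "P \<in> ?S" using assms span_minimal by blast
  then show ?thesis using that by blast
qed

lemma M_mat_carrier: "M_mat X L \<in> carrier_mat (length L) (length L)"
  by (simp add: M_mat_def)

lemma mat_inv_M_mat:
  assumes "invertible_mat (M_mat X L)"
  shows "mat_inv (M_mat X L) * M_mat X L = 1\<^sub>m (length L)"
    and "M_mat X L * mat_inv (M_mat X L) = 1\<^sub>m (length L)"
proof -
  let ?n = "length L" and ?M = "M_mat X L"
  have M: "?M \<in> carrier_mat ?n ?n" by (rule M_mat_carrier)
  obtain B where B: "?M * B = 1\<^sub>m (dim_row ?M)" "B * ?M = 1\<^sub>m (dim_row B)"
    using assms unfolding invertible_mat_def inverts_mat_def by auto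
  have d: "dim_row ?M = ?n" "dim_col ?M = ?n" using M by auto
  have "dim_col B = ?n" using arg_cong[OF B(1), of dim_col] d by simp
  moreover have "dim_row B = ?n" using arg_cong[OF B(2), of dim_col] d by simp
  ultimately have "B \<in> carrier_mat ?n ?n" by auto
  then have "?M \<in> Units (ring_mat TYPE(real) ?n ())"
    using M B d by (auto simp: Units_def ring_mat_def)
  then obtain C where "mat_inverse ?M = Some C"
    using mat_inverse(1)[OF M, where b = "()"] by (cases "mat_inverse ?M") auto
  then show "mat_inv ?M * ?M = 1\<^sub>m ?n" "?M * mat_inv ?M = 1\<^sub>m ?n"
    using mat_inverse(2)[OF M] by (auto simp: mat_inv_def)
qed

lemma invertible_M_mat_Nil: "invertible_mat (M_mat X [])"
proof -
  have "M_mat X [] = 1\<^sub>m 0" by (auto simp: M_mat_def)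
  then show ?thesis
    by (auto simp: invertible_mat_def inverts_mat_def intro!: exI[of _ "1\<^sub>m 0"])
qed

text \<open>
  The coefficients of \<open>P\<close> in the signed columns solve the Gram system with right-hand side \<open>f\<close>, so they
  are what the inverse matrix produces. With \<open>f i\<close> the inner product with \<open>y\<close>, the vector \<open>P\<close> is the
  orthogonal projection of \<open>y\<close>; with \<open>f\<close> constantly 1 it is the equiangular vector behind \<open>theta\<close>.
\<close>

lemma R_regress_eq_inner:
  assumes inv: "invertible_mat (M_mat X L)"
    and P: "P \<in> span (signed_column X ` set L)"
    and f: "\<And>i. i \<in> set L \<Longrightarrow> signed_column X i \<bullet> P = f i"
  shows "R_regress X L j (map f L) = signed_column X j \<bullet> P"
proof -
  let ?n = "length L" and ?M = "M_mat X L"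
  obtain c where c: "P = (\<Sum>k<?n. c k *\<^sub>R signed_column X (L ! k))"
    using span_image_list[OF P] by metis
  define v where "v = Matrix.vec ?n c"
  have v: "v \<in> carrier_vec ?n" by (simp add: v_def)
  have "vec_of_list (map f L) = ?M *\<^sub>v v"
  proof (rule eq_vecI)
    fix l assume l: "l < dim_vec (?M *\<^sub>v v)"
    then have l: "l < ?n" using M_mat_carrier[of X L] by simp
    then have "Matrix.vec_index (?M *\<^sub>v v) l = (\<Sum>k<?n. R_mat X (L ! l) (L ! k) * c k)"
      by (simp add: M_mat_def v_def scalar_prod_def atLeast0LessThan)
    also have "\<dots> = signed_column X (L ! l) \<bullet> P"
      by (simp add: c R_mat_eq_inner inner_sum_right mult.commute)
    also have "\<dots> = f (L ! l)" using f l by simp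
    finally show "Matrix.vec_index (vec_of_list (map f L)) l = Matrix.vec_index (?M *\<^sub>v v) l"
      using l by (simp add: vec_of_list_index)
  qed (simp add: M_mat_def)
  then have "mat_inv ?M *\<^sub>v vec_of_list (map f L) = (mat_inv ?M * ?M) *\<^sub>v v"
    using assoc_mult_mat_vec[OF mat_inv_M_mat_carrier M_mat_carrier v, of X X] by simp
  also have "\<dots> = v" using mat_inv_M_mat(1)[OF inv] v by simp
  finally have "R_regress X L j (map f L) = scalar_prod (vec_of_list (map (R_mat X j) L)) v"
    by (simp add: R_regress_def)
  also have "\<dots> = (\<Sum>k<?n. R_mat X j (L ! k) * c k)"
    by (simp add: scalar_prod_def v_def atLeast0LessThan vec_of_list_index del: vec_of_list_map)
  also have "\<dots> = signed_column X j \<bullet> P"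
    by (simp add: c R_mat_eq_inner inner_sum_right mult.commute)
  finally show ?thesis .
qed

lemma gram_solve:
  assumes inv: "invertible_mat (M_mat X L)"
  obtains P where "P \<in> span (signed_column X ` set L)"
    and "\<And>k. k < length L \<Longrightarrow> signed_column X (L ! k) \<bullet> P = g k"
proof -
  let ?n = "length L" and ?M = "M_mat X L"
  define w where "w = Matrix.vec ?n g"
  define v where "v = mat_inv ?M *\<^sub>v w"
  have w: "w \<in> carrier_vec ?n" by (simp add: w_def)
  have v: "v \<in> carrier_vec ?n"
    unfolding v_def using mat_inv_M_mat_carrier[of X L] w by (rule mult_mat_vec_carrier)
  have Mv: "?M *\<^sub>v v = w"
    unfolding v_def using assoc_mult_mat_vec[OF M_mat_carrier mat_inv_M_mat_carrier w, of X X]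
      mat_inv_M_mat(2)[OF inv] w by simp
  define P where "P = (\<Sum>k<?n. Matrix.vec_index v k *\<^sub>R signed_column X (L ! k))"
  show ?thesis
  proof (rule that[of P])
    show "P \<in> span (signed_column X ` set L)"
      unfolding P_def by (intro span_sum span_scale span_base) auto
    fix l assume l: "l < ?n"
    have "signed_column X (L ! l) \<bullet> P = (\<Sum>k<?n. R_mat X (L ! l) (L ! k) * Matrix.vec_index v k)"
      by (simp add: P_def R_mat_eq_inner inner_sum_right mult.commute)
    also have "\<dots> = Matrix.vec_index (?M *\<^sub>v v) l"
      using l v by (simp add: M_mat_def scalar_prod_def atLeast0LessThan)
    also have "\<dots> = g l" using Mv l by (simp add: w_def)
    finally show "signed_column X (L ! l) \<bullet> P = g l" .
  qed
qed

text \<open>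
  The component of \<open>x\<close> orthogonal to the span of \<open>S\<close>.
\<close>

definition perp :: "'v::euclidean_space set \<Rightarrow> 'v \<Rightarrow> 'v" where
  "perp S x = (SOME z. (\<forall>w\<in>span S. z \<bullet> w = 0) \<and> x - z \<in> span S)"

lemma perp_inner_span: "w \<in> span S \<Longrightarrow> perp S x \<bullet> w = 0"
  and diff_perp_in_span: "x - perp S x \<in> span S"
proof -
  obtain u z where "u \<in> span S" "\<And>w. w \<in> span S \<Longrightarrow> Linear_Algebra.orthogonal z w" "x = u + z"
    using orthogonal_subspace_decomp_exists[of S x] by metis
  then have "(\<forall>w\<in>span S. z \<bullet> w = 0) \<and> x - z \<in> span S"
    by (auto simp: Linear_Algebra.orthogonal_def)
  then have *: "(\<forall>w\<in>span S. perp S x \<bullet> w = 0) \<and> x - perp S x \<in> span S"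
    unfolding perp_def by (rule someI)
  then show "w \<in> span S \<Longrightarrow> perp S x \<bullet> w = 0" "x - perp S x \<in> span S" by auto
qed

lemma inner_span_zero:
  assumes "\<And>u. u \<in> S \<Longrightarrow> u \<bullet> z = 0" and "v \<in> span S"
  shows "v \<bullet> z = 0"
proof (rule span_induct[OF assms(2)])
  show "subspace {v. v \<bullet> z = 0}" by (auto simp: subspace_def inner_add_left)
qed (use assms in auto)

lemma perp_unique:
  assumes "\<And>w. w \<in> S \<Longrightarrow> w \<bullet> z = 0" and "x - z \<in> span S"
  shows "perp S x = z"
proof -
  have z: "w \<bullet> z = 0" if "w \<in> span S" for w
    using inner_span_zero[OF assms(1) that] .
  have "perp S x - z = (x - z) - (x - perp S x)" by simp
  then have "perp S x - z \<in> span S"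
    using span_diff[OF assms(2) diff_perp_in_span[of x S]] by simp
  then have "(perp S x - z) \<bullet> perp S x = 0" "(perp S x - z) \<bullet> z = 0"
    by (metis perp_inner_span inner_commute, rule z)
  then have "(perp S x - z) \<bullet> (perp S x - z) = 0" by (simp only: inner_diff_right)
  then show ?thesis by simp
qed

lemma perp_inner_perp: "perp S x \<bullet> perp S y = x \<bullet> perp S y"
proof -
  have "(x - perp S x) \<bullet> perp S y = 0"
    using perp_inner_span[OF diff_perp_in_span] by (metis inner_commute)
  then show ?thesis by (simp add: inner_diff_left)
qed


section \<open>The knots along an irrepresentable tuple\<close>

text \<open>
  The direction $w_k$ whose inner product with $y$ is the $k$-th knot on the path \<open>idx\<close>; like the knots
  and scales, directions are counted from 1.
\<close>

definition lars_dir :: "real^'p^'n \<Rightarrow> ('p + 'p) list \<Rightarrow> nat \<Rightarrow> real^'n" where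
  "lars_dir X idx k =
     (let prev = take (k - 1) idx; j = idx ! (k - 1) in
      (1 / (1 - theta X prev j)) *\<^sub>R perp (signed_column X ` set prev) (signed_column X j))"

lemma arg_max_finite:
  fixes f :: "'a::finite \<Rightarrow> real"
  assumes "P x"
  shows "P (arg_max f P)" and "f x \<le> f (arg_max f P)"
proof -
  have ne: "f ` {x. P x} \<noteq> {}" using assms by auto
  obtain z where z: "P z" "f z = Max (f ` {x. P x})"
    using Max_in[OF _ ne] by auto
  then have "is_arg_max f P z" by (auto simp: is_arg_max_linorder)
  then have "is_arg_max f P (arg_max f P)" unfolding arg_max_def by (rule someI)
  then show "P (arg_max f P)" "f x \<le> f (arg_max f P)"
    using assms by (auto simp: is_arg_max_linorder)
qed

lemma arg_max_strict:
  fixes f :: "'a::finite \<Rightarrow> real"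
  assumes "P x" and "\<And>z. P z \<Longrightarrow> z \<noteq> x \<Longrightarrow> f z < f x"
  shows "arg_max f P = x"
  using arg_max_finite[of P x f, OF assms(1)] assms(2)[of "arg_max f P"] by force

lemma length_lars_path [simp]: "length (lars_path X y k) = k"
  by (induction k) auto

lemma take_lars_path: "k \<le> m \<Longrightarrow> take k (lars_path X y m) = lars_path X y k"
  by (induction m) (auto simp: le_Suc_eq)

lemma lars_index_eq_iff:
  "(\<forall>k\<in>{1..length idx}. lars_index X y k = idx ! (k - 1)) \<longleftrightarrow> lars_path X y (length idx) = idx"
proof -
  have "lars_index X y (Suc k) = lars_path X y (length idx) ! k" if "k < length idx" for k
    using take_lars_path[of "Suc k" "length idx" X y] that
    by (metis diff_Suc_1 lars_index_def lessI less_eq_Suc_le nth_take)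
  then have "(\<forall>k\<in>{1..length idx}. lars_index X y k = idx ! (k - 1)) \<longleftrightarrow>
      (\<forall>k<length idx. lars_path X y (length idx) ! k = idx ! k)"
    by (auto simp: Ball_def) (metis Suc_le_eq Suc_le_mono Suc_pred diff_Suc_1 le0 One_nat_def)+
  then show ?thesis by (auto intro: nth_equalityI)
qed

locale irrepresentable_tuple =
  fixes X :: "real^'p^'n" and idx :: "('p + 'p) list"
  assumes distinct_idx: "distinct idx"
    and irrepresentable: "irrepresentable_check X idx"
begin

abbreviation resid :: "nat \<Rightarrow> 'p + 'p \<Rightarrow> real^'n" where
  "resid k j \<equiv> perp (signed_column X ` set (take k idx)) (signed_column X j)"

abbreviation slack :: "nat \<Rightarrow> 'p + 'p \<Rightarrow> real" where
  "slack k j \<equiv> 1 - theta X (take k idx) j"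

lemma invertible_take:
  assumes "k \<le> length idx" shows "invertible_mat (M_mat X (take k idx))"
  using assms irrepresentable invertible_M_mat_Nil
  by (cases "k = 0") (auto simp: irrepresentable_check_def)

lemma theta_eq_inner:
  assumes "k \<le> length idx"
  obtains q where "q \<in> span (signed_column X ` set (take k idx))"
    and "\<And>i. i \<in> set (take k idx) \<Longrightarrow> signed_column X i \<bullet> q = 1"
    and "\<And>j. theta X (take k idx) j = signed_column X j \<bullet> q"
proof -
  obtain q where q: "q \<in> span (signed_column X ` set (take k idx))"
    "\<And>l. l < length (take k idx) \<Longrightarrow> signed_column X (take k idx ! l) \<bullet> q = 1"
    using gram_solve[OF invertible_take[OF assms], of "\<lambda>_. 1"] by blast
  have q2: "signed_column X i \<bullet> q = 1" if "i \<in> set (take k idx)" for i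
    using q(2) that by (metis in_set_conv_nth)
  show ?thesis
    using R_regress_eq_inner[OF invertible_take[OF assms] q(1), of "\<lambda>_. 1"] q2
    by (intro that[OF q(1)]) (auto simp: theta_def)
qed

lemma theta_unique:
  assumes "k \<le> length idx" and "q \<in> span (signed_column X ` set (take k idx))"
    and "\<And>i. i \<in> set (take k idx) \<Longrightarrow> signed_column X i \<bullet> q = 1"
  shows "theta X (take k idx) j = signed_column X j \<bullet> q"
  using R_regress_eq_inner[OF invertible_take[OF assms(1)] assms(2), of "\<lambda>_. 1"] assms(3)
  by (auto simp: theta_def)

lemma slack_pos:
  assumes "k \<le> length idx" and "j \<notin> set (take k idx)" shows "slack k j > 0"
  using assms irrepresentable
  by (cases "k = 0") (auto simp: irrepresentable_check_def theta_Nil)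

lemma theta_less_1_iff:
  assumes "k \<le> length idx"
  shows "theta X (take k idx) j < 1 \<longleftrightarrow> j \<notin> set (take k idx)"
  using slack_pos[OF assms, of j] theta_eq_inner[OF assms] by force

lemma nth_notin_take: "k < length idx \<Longrightarrow> idx ! k \<notin> set (take k idx)"
  using distinct_idx by (auto simp: in_set_conv_nth nth_eq_iff_index_eq)

lemma set_take_Suc: "k < length idx \<Longrightarrow> set (take (Suc k) idx) = insert (idx ! k) (set (take k idx))"
  by (simp add: take_Suc_conv_app_nth)

lemma lars_ratio_eq:
  assumes "k \<le> length idx"
  shows "lars_ratio X y (take k idx) j = (resid k j \<bullet> y) / slack k j"
proof -
  let ?S = "signed_column X ` set (take k idx)"
  have "Pi_proj X y (take k idx) j = signed_column X j \<bullet> (y - perp ?S y)"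
    unfolding Pi_proj_def
  proof (rule R_regress_eq_inner[OF invertible_take[OF assms] diff_perp_in_span])
    fix i assume "i \<in> set (take k idx)"
    then have "perp ?S y \<bullet> signed_column X i = 0"
      by (intro perp_inner_span span_base) auto
    then show "signed_column X i \<bullet> (y - perp ?S y) = Z_vec X y i"
      by (simp add: Z_vec_eq_inner inner_diff_right inner_commute)
  qed
  then have "Z_vec X y j - Pi_proj X y (take k idx) j = resid k j \<bullet> y"
    using perp_inner_perp[of ?S "signed_column X j" y] perp_inner_perp[of ?S y "signed_column X j"]
    by (simp add: Z_vec_eq_inner inner_diff_right inner_commute)
  then show ?thesis by (simp add: lars_ratio_def)
qed

lemma rho_eq_norm:
  assumes k: "k \<le> length idx" and L: "take k L = take k idx" and j: "j = L ! k"
    and notin: "j \<notin> set (take k idx)"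
  shows "rho X L (Suc k) = norm (resid k j) / slack k j"
proof (cases "k = 0")
  case True
  have "resid k j = signed_column X j"
    using True by (intro perp_unique) auto
  then show ?thesis
    using True j by (simp add: rho_def Let_def theta_Nil R_mat_eq_inner norm_eq_sqrt_inner)
next
  case False
  let ?S = "signed_column X ` set (take k idx)" and ?x = "signed_column X j"
  have "R_regress X (take k idx) j (map (R_mat X j) (take k idx)) = ?x \<bullet> (?x - resid k j)"
  proof (rule R_regress_eq_inner[OF invertible_take[OF k] diff_perp_in_span])
    fix i assume "i \<in> set (take k idx)"
    then have "resid k j \<bullet> signed_column X i = 0"
      by (intro perp_inner_span span_base) auto
    then show "signed_column X i \<bullet> (?x - resid k j) = R_mat X j i"
      by (simp add: R_mat_eq_inner inner_diff_right inner_commute)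
  qed
  then have "R_mat X j j - R_regress X (take k idx) j (map (R_mat X j) (take k idx)) =
      resid k j \<bullet> resid k j"
    by (simp add: R_mat_eq_inner inner_diff_right perp_inner_perp)
  then show ?thesis
    using False j L by (simp add: rho_def Let_def norm_eq_sqrt_inner)
qed

text \<open>
  A zero residual puts the new column into the span of the old ones. But by invertibility of the Gram
  matrix some vector is orthogonal to the old columns and not to the new one.
\<close>

lemma resid_nth_nonzero:
  assumes k: "k < length idx" shows "resid k (idx ! k) \<noteq> 0"
proof
  assume 0: "resid k (idx ! k) = 0"
  let ?T = "take (Suc k) idx"
  \<comment> \<open>orthogonal to the first \<open>k\<close> columns of the tuple, but not to the next one\<close>
  obtain P where "\<And>l. l < length ?T \<Longrightarrow> signed_column X (?T ! l) \<bullet> P = (if l = k then 1 else 0)"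
    using gram_solve[OF invertible_take[of "Suc k"], of "\<lambda>l. if l = k then 1 else 0"] k by auto
  then have P: "\<And>l. l \<le> k \<Longrightarrow> signed_column X (idx ! l) \<bullet> P = (if l = k then 1 else 0)"
    using k by (metis Suc_leI length_take less_Suc_eq_le min.absorb2 nth_take)
  have "signed_column X (idx ! k) \<in> span (signed_column X ` set (take k idx))"
    using diff_perp_in_span[of "signed_column X (idx ! k)"] 0 by (metis diff_zero)
  moreover have "v \<bullet> P = 0" if "v \<in> span (signed_column X ` set (take k idx))" for v
  proof (rule inner_span_zero[OF _ that])
    fix v assume "v \<in> signed_column X ` set (take k idx)"
    then obtain l where "l < k" "v = signed_column X (idx ! l)"
      using k by (auto simp: in_set_conv_nth)
    then show "v \<bullet> P = 0" using P[of l] by simp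
  qed
  ultimately show False using P[of k] by auto
qed

abbreviation w :: "nat \<Rightarrow> real^'n" where "w \<equiv> lars_dir X idx"

lemma w_Suc: "w (Suc k) = (1 / slack k (idx ! k)) *\<^sub>R resid k (idx ! k)"
  by (simp add: lars_dir_def Let_def)

lemma slack_nth_pos: "k < length idx \<Longrightarrow> slack k (idx ! k) > 0"
  using slack_pos[of k "idx ! k"] nth_notin_take[of k] by simp

lemma w_nonzero_Suc: "k < length idx \<Longrightarrow> w (Suc k) \<noteq> 0"
  using resid_nth_nonzero slack_nth_pos[of k] by (simp add: w_Suc)

lemma resid_nth: "k < length idx \<Longrightarrow> resid k (idx ! k) = slack k (idx ! k) *\<^sub>R w (Suc k)"
  using slack_nth_pos[of k] by (simp add: w_Suc)

lemma norm_w: "k < length idx \<Longrightarrow> norm (w (Suc k)) = rho X idx (Suc k)"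
  using slack_nth_pos[of k]
  by (subst rho_eq_norm[of k idx "idx ! k"]) (auto simp: w_Suc nth_notin_take)

lemma w_inner_span: "v \<in> span (signed_column X ` set (take k idx)) \<Longrightarrow> w (Suc k) \<bullet> v = 0"
  by (simp add: w_Suc perp_inner_span)

lemma w_in_span:
  assumes "k < length idx" shows "w (Suc k) \<in> span (signed_column X ` set (take (Suc k) idx))"
proof -
  let ?x = "signed_column X (idx ! k)"
  have "?x - (?x - resid k (idx ! k)) \<in> span (signed_column X ` set (take (Suc k) idx))"
    by (intro span_diff span_base subsetD[OF span_mono diff_perp_in_span])
      (auto simp: set_take_Suc[OF assms])
  then show ?thesis by (simp add: w_Suc span_scale)
qed

lemma w_orthogonal_Suc:
  assumes "k < length idx" "l < length idx" "k \<noteq> l"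
  shows "w (Suc k) \<bullet> w (Suc l) = 0"
proof -
  have *: "w (Suc l) \<bullet> w (Suc k) = 0" if "k < l" "l < length idx" for k l
  proof (rule w_inner_span)
    have "w (Suc k) \<in> span (signed_column X ` set (take (Suc k) idx))"
      using that w_in_span by simp
    moreover have "set (take (Suc k) idx) \<subseteq> set (take l idx)"
      using that by (intro set_take_subset_set_take) simp
    ultimately show "w (Suc k) \<in> span (signed_column X ` set (take l idx))"
      by (metis image_mono span_mono subsetD)
  qed
  show ?thesis using assms *[of k l] *[of l k] by (metis inner_commute linorder_neqE_nat)
qed

text \<open>
  The span grows by the direction \<open>w (Suc k)\<close>, which is orthogonal to the previous span.
\<close>

lemma resid_Suc:
  assumes k: "k < length idx"
  shows "resid (Suc k) j =
    resid k j - ((signed_column X j \<bullet> w (Suc k)) / (w (Suc k) \<bullet> w (Suc k))) *\<^sub>R w (Suc k)"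
    (is "_ = _ - ?c *\<^sub>R _")
proof (rule perp_unique)
  let ?S = "signed_column X ` set (take k idx)" and ?T = "signed_column X ` set (take (Suc k) idx)"
  have ww: "w (Suc k) \<bullet> w (Suc k) \<noteq> 0" using w_nonzero_Suc[OF k] by simp
  fix v assume "v \<in> ?T"
  then consider "v \<in> ?S" | "v = signed_column X (idx ! k)"
    using set_take_Suc[OF k] by auto
  then show "v \<bullet> (resid k j - ?c *\<^sub>R w (Suc k)) = 0"
  proof cases
    case 1
    then show ?thesis
      using perp_inner_span[OF span_base[OF 1]] w_inner_span[OF span_base[OF 1]]
      by (simp add: inner_diff_right inner_commute)
  next
    case 2
    have "v \<bullet> resid k j = resid k (idx ! k) \<bullet> signed_column X j"
      unfolding 2 by (metis perp_inner_perp inner_commute)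
    moreover have "v \<bullet> w (Suc k) = resid k (idx ! k) \<bullet> w (Suc k)"
      unfolding 2 w_Suc by (simp add: perp_inner_perp)
    ultimately show ?thesis
      using ww resid_nth[OF k] by (simp add: inner_diff_right inner_commute)
  qed
next
  have "signed_column X j - (resid k j - ?c *\<^sub>R w (Suc k)) =
      (signed_column X j - resid k j) + ?c *\<^sub>R w (Suc k)" by simp
  also have "\<dots> \<in> span (signed_column X ` set (take (Suc k) idx))"
    by (intro span_add span_scale w_in_span k subsetD[OF span_mono diff_perp_in_span])
      (auto simp: set_take_Suc[OF k])
  finally show "signed_column X j - (resid k j - ?c *\<^sub>R w (Suc k)) \<in>
      span (signed_column X ` set (take (Suc k) idx))" .
qed

text \<open>
  The equiangular vector moves along \<open>w (Suc k)\<close> as well, and the scaling of \<open>w (Suc k)\<close> is such that the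
  inner product with the new column becomes 1.
\<close>

lemma theta_Suc:
  assumes k: "k < length idx"
  shows "theta X (take (Suc k) idx) j =
    theta X (take k idx) j + (signed_column X j \<bullet> w (Suc k)) / (w (Suc k) \<bullet> w (Suc k))"
proof -
  let ?w = "w (Suc k)"
  have ww: "?w \<bullet> ?w \<noteq> 0" using w_nonzero_Suc[OF k] by simp
  obtain q where q: "q \<in> span (signed_column X ` set (take k idx))"
    "\<And>i. i \<in> set (take k idx) \<Longrightarrow> signed_column X i \<bullet> q = 1"
    "\<And>j. theta X (take k idx) j = signed_column X j \<bullet> q"
    using theta_eq_inner[of k] k by auto
  have "theta X (take (Suc k) idx) j = signed_column X j \<bullet> (q + (1 / (?w \<bullet> ?w)) *\<^sub>R ?w)"
  proof (rule theta_unique)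
    show "Suc k \<le> length idx" using k by simp
    show "q + (1 / (?w \<bullet> ?w)) *\<^sub>R ?w \<in> span (signed_column X ` set (take (Suc k) idx))"
      by (intro span_add span_scale w_in_span k subsetD[OF span_mono q(1)])
        (auto simp: set_take_Suc[OF k])
    fix i assume "i \<in> set (take (Suc k) idx)"
    then consider "i \<in> set (take k idx)" | "i = idx ! k" using set_take_Suc[OF k] by auto
    then show "signed_column X i \<bullet> (q + (1 / (?w \<bullet> ?w)) *\<^sub>R ?w) = 1"
    proof cases
      case 1
      then have "?w \<bullet> signed_column X i = 0" by (intro w_inner_span span_base) auto
      then show ?thesis using q(2)[OF 1] by (simp add: inner_add_right inner_commute)
    next
      case 2
      have "signed_column X i \<bullet> ?w = resid k (idx ! k) \<bullet> ?w"
        unfolding 2 w_Suc by (simp add: perp_inner_perp)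
      also have "\<dots> = slack k (idx ! k) * (?w \<bullet> ?w)" using resid_nth[OF k] by simp
      finally show ?thesis using ww q(3)[of i] 2 by (simp add: inner_add_right)
    qed
  qed
  then show ?thesis using q(3)[of j] by (simp add: inner_add_right)
qed

text \<open>
  The residual of \<open>j\<close> minus $L$ times the slack of \<open>j\<close> changes, from step \<open>k\<close> to \<open>Suc k\<close>, by a multiple
  of $\langle w_{k+1}, y \rangle - L$, because residual and slack change by the same coefficient
  (\<open>resid_Suc\<close>, \<open>theta_Suc\<close>). At the knot $L$ this is zero. Both slacks are positive, so the sign of the
  difference tells on which side of $L$ the ratio is.
\<close>

lemma lars_ratio_Suc_cmp:
  fixes y :: "real^'n"
  assumes k: "k < length idx" and j: "j \<notin> set (take (Suc k) idx)"
  defines "L \<equiv> w (Suc k) \<bullet> y"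
  shows "lars_ratio X y (take (Suc k) idx) j \<le> L \<longleftrightarrow> lars_ratio X y (take k idx) j \<le> L"
    and "lars_ratio X y (take (Suc k) idx) j < L \<longleftrightarrow> lars_ratio X y (take k idx) j < L"
proof -
  have pos: "slack k j > 0" "slack (Suc k) j > 0"
    using k j by (auto intro!: slack_pos simp del: diff_gt_0_iff_gt simp: set_take_Suc[OF k])
  have eq: "resid (Suc k) j \<bullet> y - L * slack (Suc k) j = resid k j \<bullet> y - L * slack k j"
    unfolding resid_Suc[OF k] theta_Suc[OF k] L_def
    by (simp add: inner_diff_left algebra_simps)
  have r: "lars_ratio X y (take k idx) j = (resid k j \<bullet> y) / slack k j"
    "lars_ratio X y (take (Suc k) idx) j = (resid (Suc k) j \<bullet> y) / slack (Suc k) j"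
    using k by (auto intro!: lars_ratio_eq)
  show "lars_ratio X y (take (Suc k) idx) j \<le> L \<longleftrightarrow> lars_ratio X y (take k idx) j \<le> L"
    unfolding r pos_divide_le_eq[OF pos(1)] pos_divide_le_eq[OF pos(2)] using eq by linarith
  show "lars_ratio X y (take (Suc k) idx) j < L \<longleftrightarrow> lars_ratio X y (take k idx) j < L"
    unfolding r pos_divide_less_eq[OF pos(1)] pos_divide_less_eq[OF pos(2)] using eq by linarith
qed

lemma lars_ratio_nth:
  "k < length idx \<Longrightarrow> lars_ratio X y (take k idx) (idx ! k) = w (Suc k) \<bullet> y"
  by (simp add: lars_ratio_eq w_Suc)


text \<open>
  The knots that the path would have if it followed \<open>idx\<close>, defined for every \<open>y\<close>. They agree with
  \<open>lars_knot\<close> on the selection event only.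
\<close>

definition tuple_knot :: "real^'n \<Rightarrow> nat \<Rightarrow> ereal" where
  "tuple_knot y k =
     (if k = 0 then \<infinity>
      else if k \<le> length idx then ereal (w k \<bullet> y)
      else ereal (Max (lars_ratio X y idx ` {j. theta X idx j < 1})))"

text \<open>
  On the selection event the tuple knots descend weakly; these are the equalities that have to be
  excluded for a strict descent.
\<close>

definition tie_free :: "real^'n \<Rightarrow> bool" where
  "tie_free y \<longleftrightarrow>
     (\<forall>k. Suc k < length idx \<longrightarrow> w (Suc k) \<bullet> y \<noteq> w (Suc (Suc k)) \<bullet> y) \<and>
     (\<forall>k j. length idx = Suc k \<longrightarrow> j \<notin> set idx \<longrightarrow>
        resid (length idx) j \<bullet> y \<noteq> slack (length idx) j * (w (Suc k) \<bullet> y))"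

lemma theta_less_1_set: "{j. theta X idx j < 1} = - set idx"
  using theta_less_1_iff[of "length idx"] by auto

text \<open>
  Downward induction on \<open>k\<close>: at the last step the ratios are below the maximum that defines the last
  tuple knot. At an earlier step, the bound by the next knot is carried back by \<open>lars_ratio_Suc_cmp\<close> and
  combined with the descent; the variable entering next is compared directly.
\<close>

lemma lars_ratio_less_of_descends:
  assumes d: "descends 0 (Suc (length idx)) (tuple_knot y)"
    and k: "k < length idx" and j: "j \<notin> set (take (Suc k) idx)"
  shows "lars_ratio X y (take (Suc k) idx) j < w (Suc k) \<bullet> y"
  using k j
proof (induction "length idx - Suc k" arbitrary: k)
  case 0
  then have K: "length idx = Suc k" by simp
  have "lars_ratio X y idx j \<le> Max (lars_ratio X y idx ` {j. theta X idx j < 1})"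
    using 0 K theta_less_1_set by (intro Max_ge) auto
  moreover have "tuple_knot y (Suc (Suc k)) < tuple_knot y (Suc k)"
    using d K by (auto simp: descends_def)
  ultimately show ?case using K by (simp add: tuple_knot_def)
next
  case (Suc n)
  then have k': "Suc k < length idx" by simp
  have "tuple_knot y (Suc (Suc k)) < tuple_knot y (Suc k)"
    using d k' by (auto simp: descends_def)
  then have L: "w (Suc (Suc k)) \<bullet> y < w (Suc k) \<bullet> y"
    using k' by (simp add: tuple_knot_def)
  show ?case
  proof (cases "j = idx ! Suc k")
    case True then show ?thesis using L lars_ratio_nth[OF k'] by simp
  next
    case False
    then have j': "j \<notin> set (take (Suc (Suc k)) idx)" using Suc.prems(2) set_take_Suc[OF k'] by simp
    have "lars_ratio X y (take (Suc (Suc k)) idx) j < w (Suc (Suc k)) \<bullet> y"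
      using Suc.hyps(1)[of "Suc k"] Suc.hyps(2) k' j' by simp
    then show ?thesis using lars_ratio_Suc_cmp(2)[OF k' j'] L by fastforce
  qed
qed

lemma lars_path_of_descends:
  assumes d: "descends 0 (Suc (length idx)) (tuple_knot y)" and "k \<le> length idx"
  shows "lars_path X y k = take k idx"
  using assms(2)
proof (induction k)
  case (Suc k)
  then have k: "k < length idx" by simp
  have "arg_max (lars_ratio X y (take k idx)) (\<lambda>j. theta X (take k idx) j < 1) = idx ! k"
  proof (rule arg_max_strict)
    show "theta X (take k idx) (idx ! k) < 1"
      using theta_less_1_iff[of k] k nth_notin_take by simp
    fix j assume "theta X (take k idx) j < 1" "j \<noteq> idx ! k"
    then have "j \<notin> set (take (Suc k) idx)" using theta_less_1_iff[of k j] k set_take_Suc[OF k] by simp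
    then show "lars_ratio X y (take k idx) j < lars_ratio X y (take k idx) (idx ! k)"
      using lars_ratio_less_of_descends[OF d k] lars_ratio_Suc_cmp(2)[OF k] lars_ratio_nth[OF k] by simp
  qed
  then show ?case using Suc k by (simp add: take_Suc_conv_app_nth)
qed simp

lemma lars_ratio_le_of_path:
  assumes path: "lars_path X y (length idx) = idx" and k: "k < length idx" and j: "j \<notin> set (take k idx)"
  shows "lars_ratio X y (take k idx) j \<le> w (Suc k) \<bullet> y"
proof -
  have "take (Suc k) idx = lars_path X y (Suc k)" "take k idx = lars_path X y k"
    using take_lars_path[of _ "length idx" X y] path k by (metis Suc_leI, metis less_imp_le)
  then have "idx ! k = arg_max (lars_ratio X y (take k idx)) (\<lambda>j. theta X (take k idx) j < 1)"
    using k by (simp add: take_Suc_conv_app_nth)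
  then show ?thesis
    using arg_max_finite(2)[of "\<lambda>j. theta X (take k idx) j < 1" j "lars_ratio X y (take k idx)"] lars_ratio_nth[OF k, of y]
      theta_less_1_iff[of k j] k j by simp
qed

lemma lars_knot_of_path:
  assumes path: "lars_path X y (length idx) = idx" and "k \<le> Suc (length idx)"
  shows "lars_knot X y k = tuple_knot y k"
proof -
  consider "k = 0" | l where "k = Suc l" "l < length idx" | "k = Suc (length idx)"
    using assms(2) by (metis le_Suc_eq less_eq_Suc_le not0_implies_Suc)
  then show ?thesis
  proof cases
    case 2
    have "take l idx = lars_path X y l"
      using take_lars_path[of l "length idx" X y] path 2 by simp
    moreover have "Max (lars_ratio X y (take l idx) ` {j. theta X (take l idx) j < 1}) = w (Suc l) \<bullet> y"
    proof (rule Max_eqI)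
      show "w (Suc l) \<bullet> y \<in> lars_ratio X y (take l idx) ` {j. theta X (take l idx) j < 1}"
        using 2 lars_ratio_nth[of l y] theta_less_1_iff[of l] nth_notin_take[of l]
        by (intro image_eqI[of _ _ "idx ! l"]) auto
    qed (use lars_ratio_le_of_path[OF path 2(2)] theta_less_1_iff[of l] 2 in auto)
    ultimately show ?thesis using 2 by (simp add: lars_knot_def tuple_knot_def)
  qed (use path in \<open>auto simp: lars_knot_def tuple_knot_def\<close>)
qed

text \<open>
  On the path, a knot bounds all ratios of its step, hence by \<open>lars_ratio_Suc_cmp\<close> all ratios of the next
  step, and the next knot is one of those.
\<close>

lemma descends_of_path:
  assumes path: "lars_path X y (length idx) = idx" and "tie_free y"
  shows "descends 0 (Suc (length idx)) (tuple_knot y)"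
  unfolding descends_def
proof
  fix i assume "i \<in> {0..<Suc (length idx)}"
  then consider "i = 0" | k where "i = Suc k" "Suc k < length idx" | k where "i = Suc k" "length idx = Suc k"
    by (cases i) (auto simp: less_Suc_eq)
  then show "tuple_knot y (Suc i) < tuple_knot y i"
  proof cases
    case 2
    have "idx ! Suc k \<notin> set (take (Suc k) idx)" using nth_notin_take 2 by blast
    then have "lars_ratio X y (take (Suc k) idx) (idx ! Suc k) \<le> w (Suc k) \<bullet> y"
      using lars_ratio_le_of_path[OF path, of k] lars_ratio_Suc_cmp(1)[of k] 2 by (simp add: set_take_Suc)
    then show ?thesis using \<open>tie_free y\<close> 2 lars_ratio_nth[of "Suc k" y]
      by (force simp: tie_free_def tuple_knot_def)
  next
    case 3
    have "lars_ratio X y idx j < w (Suc k) \<bullet> y" if j: "j \<notin> set idx" for j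
    proof -
      have "lars_ratio X y idx j \<le> w (Suc k) \<bullet> y"
        using lars_ratio_le_of_path[OF path, of k j] lars_ratio_Suc_cmp(1)[of k j y] 3 j
        by (auto dest: in_set_takeD)
      moreover have "slack (length idx) j > 0" using slack_pos[of "length idx" j] j by simp
      then have "lars_ratio X y idx j \<noteq> w (Suc k) \<bullet> y"
        using \<open>tie_free y\<close> 3 j lars_ratio_eq[of "length idx" y j]
        by (auto simp: tie_free_def field_simps)
      ultimately show ?thesis by simp
    qed
    then show ?thesis
      using 3 theta_lt_1_nonempty[of X idx] theta_less_1_set by (auto simp: tuple_knot_def)
  qed (simp add: tuple_knot_def)
qed

end


section \<open>Measurability of the path and of the statistic\<close>

lemma R_regress_eq_sum:
  "length w = length L \<Longrightarrow> R_regress X L j w =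
    (\<Sum>i<length L. R_mat X j (L ! i) * (\<Sum>k<length L. mat_inv (M_mat X L) $$ (i, k) * w ! k))"
  using mat_inv_M_mat_carrier[of X L]
  by (simp add: R_regress_def scalar_prod_def atLeast0LessThan vec_of_list_index del: vec_of_list_map)

lemma borel_measurable_Z_vec [measurable]: "(\<lambda>y. Z_vec X y i) \<in> borel_measurable borel"
  unfolding Z_vec_eq_inner by measurable

lemma borel_measurable_lars_ratio [measurable]:
  "(\<lambda>y. lars_ratio X y L j) \<in> borel_measurable borel"
proof -
  have "(\<lambda>y. Pi_proj X y L j) \<in> borel_measurable borel"
    unfolding Pi_proj_def by (subst R_regress_eq_sum) simp_all
  then show ?thesis unfolding lars_ratio_def by measurable
qed

text \<open>
  The choice among several maximizers depends only on the set of maximizers.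
\<close>

lemma measurable_arg_max:
  fixes f :: "'a \<Rightarrow> 'i::finite \<Rightarrow> real"
  assumes [measurable]: "\<And>i. (\<lambda>y. f y i) \<in> borel_measurable M"
  shows "(\<lambda>y. arg_max (f y) P) \<in> measurable M (count_space UNIV)"
proof -
  have "(\<lambda>y. {x. is_arg_max (f y) P x}) \<in> measurable M (count_space UNIV)"
    unfolding measurable_count_space_eq2_countable
  proof (intro conjI ballI)
    fix A :: "'i set"
    have "(\<lambda>y. {x. is_arg_max (f y) P x}) -` {A} \<inter> space M =
        {y \<in> space M. \<forall>x. x \<in> A \<longleftrightarrow> P x \<and> (\<forall>z. P z \<longrightarrow> f y z \<le> f y x)}"
      unfolding is_arg_max_linorder by auto
    also have "\<dots> \<in> sets M" by measurable
    finally show "(\<lambda>y. {x. is_arg_max (f y) P x}) -` {A} \<inter> space M \<in> sets M" .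
  qed simp
  then have "(\<lambda>y. (\<lambda>A. SOME x. x \<in> A) {x. is_arg_max (f y) P x}) \<in> measurable M (count_space UNIV)"
    by (rule measurable_compose) simp
  then show ?thesis by (simp add: arg_max_def)
qed

lemma measurable_lars_path [measurable]:
  "(\<lambda>y. lars_path X y k) \<in> measurable borel (count_space UNIV)"
proof (induction k)
  case (Suc k)
  have "(\<lambda>y. L @ [arg_max (lars_ratio X y L) (\<lambda>j. theta X L j < 1)]) \<in> measurable borel (count_space UNIV)" for L
    by (rule measurable_compose[OF measurable_arg_max]) simp_all
  from measurable_compose_countable[OF this Suc] show ?case by simp
qed simp

lemma borel_measurable_lars_knot [measurable]: "(\<lambda>y. lars_knot X y k) \<in> borel_measurable borel"
proof (cases "k = 0")
  case False
  have "(\<lambda>y. ereal (Max (lars_ratio X y L ` {j. theta X L j < 1}))) \<in> borel_measurable borel" for L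
    by measurable
  from measurable_compose_countable[OF this measurable_lars_path]
  show ?thesis using False by (simp add: lars_knot_def)
qed (simp add: lars_knot_def)

lemma P_tr_cong:
  assumes "\<rho> i = \<rho>' i" "\<rho> j = \<rho>' j" shows "P_tr \<sigma> \<rho> i j = P_tr \<sigma> \<rho>' i j"
proof -
  have "Phi_sc \<sigma> \<rho> i = Phi_sc \<sigma> \<rho>' i" "Phi_sc \<sigma> \<rho> j = Phi_sc \<sigma> \<rho>' j"
    using assms by (auto simp: Phi_sc_def fun_eq_iff)
  then show ?thesis by (intro ext) (simp add: P_tr_def)
qed

text \<open>
  Along a path of which only the first \<open>c\<close> entries are known, the scales are determined up to \<open>c\<close> only.
  Countably many cases then suffice for measurability.
\<close>

lemma I_int_cong:
  assumes "\<And>i. i \<le> b \<Longrightarrow> \<rho> i = \<rho>' i"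
  shows "I_int \<sigma> \<rho> a b = I_int \<sigma> \<rho>' a b"
proof (induction "b - a" arbitrary: a)
  case (0 a)
  then show ?case by (auto simp: fun_eq_iff I_int.simps[of _ _ a b])
next
  case (Suc n a)
  show ?case
  proof (cases "b \<le> a + 1")
    case True
    then show ?thesis by (auto simp: fun_eq_iff I_int.simps[of _ _ a b])
  next
    case False
    then have "I_int \<sigma> \<rho> (a + 1) b = I_int \<sigma> \<rho>' (a + 1) b"
      "P_tr \<sigma> \<rho> (a + 1) b = P_tr \<sigma> \<rho>' (a + 1) b" "P_tr \<sigma> \<rho> (a + 1) a = P_tr \<sigma> \<rho>' (a + 1) a"
      using Suc assms by (auto intro!: P_tr_cong)
    then show ?thesis by (simp add: fun_eq_iff I_int.simps[of _ _ a b])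
  qed
qed

lemma F_abc_cong:
  assumes "a < b" "b < c" and \<rho>: "\<And>i. i \<le> c \<Longrightarrow> \<rho> i = \<rho>' i" and lam: "lam a = lam' a" "lam c = lam' c"
  shows "F_abc \<sigma> \<rho> lam a b c t = F_abc \<sigma> \<rho>' lam' a b c t"
proof -
  have P: "Phi_sc \<sigma> \<rho> i = Phi_sc \<sigma> \<rho>' i" if "i \<le> c" for i
    using \<rho>[OF that] by (auto simp: Phi_sc_def fun_eq_iff)
  have "F_val \<sigma> \<rho> lam i = F_val \<sigma> \<rho>' lam' i" if "i = a \<or> i = c" for i
    using that assms P[of i] by (auto simp: F_val_def)
  moreover have "I_int \<sigma> \<rho> a b = I_int \<sigma> \<rho>' a b" "I_int \<sigma> \<rho> b c = I_int \<sigma> \<rho>' b c"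
    using assms by (auto intro!: I_int_cong)
  ultimately show ?thesis using P[of b] assms by (simp add: F_abc_def)
qed

lemma borel_measurable_F_abc [measurable (raw)]:
  assumes [measurable]: "\<And>i. (\<lambda>y. lam y i) \<in> borel_measurable M" "t \<in> borel_measurable M"
  shows "(\<lambda>y. F_abc \<sigma> \<rho> (lam y) a b c (t y)) \<in> borel_measurable M"
proof -
  have F [measurable]: "(\<lambda>y. F_val \<sigma> \<rho> (lam y) i) \<in> borel_measurable M" for i
    by (cases "i = 0") (simp_all add: F_val_def)
  have [measurable]: "(\<lambda>y. indicator {lam y c..lam y a} (t y) :: real) \<in> borel_measurable M"
    by (simp add: indicator_def)
  show ?thesis
    unfolding F_abc_def
    by (intro borel_measurable_times borel_measurable_interval_integral) measurable
qed

lemma borel_measurable_alpha_hat [measurable]: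
  assumes "a < b" "b < c"
  shows "(\<lambda>y. alpha_hat \<sigma> X y a b c) \<in> borel_measurable borel"
proof -
  define \<rho> where "\<rho> = (\<lambda>L l. rho X (take l L) l)"
  let ?f = "\<lambda>L y. 1 - F_abc \<sigma> (\<rho> L) (lars_knot X y) a b c (lars_knot X y b) /
    F_abc \<sigma> (\<rho> L) (lars_knot X y) a b c (lars_knot X y a)"
  have "?f L \<in> borel_measurable borel" for L by measurable
  from measurable_compose_countable[OF this measurable_lars_path[of X c]]
  have "(\<lambda>y. ?f (lars_path X y c) y) \<in> borel_measurable borel" .
  moreover have "alpha_hat \<sigma> X y a b c = ?f (lars_path X y c) y" for y
  proof -
    have "F_abc \<sigma> (\<lambda>l. rho X (lars_path X y l) l) (lars_knot X y) a b c t =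
        F_abc \<sigma> (\<rho> (lars_path X y c)) (lars_knot X y) a b c t" for t
      using assms by (intro F_abc_cong) (auto simp: \<rho>_def take_lars_path)
    then show ?thesis by (simp add: alpha_hat_def Let_def)
  qed
  ultimately show ?thesis by simp
qed


section \<open>Resampled knots\<close>

lemma perp_minus: "perp S (- x) = - perp S x"
proof (rule perp_unique)
  show "v \<bullet> - perp S x = 0" if "v \<in> S" for v
    using perp_inner_span[OF span_base[OF that], of x] by (simp add: inner_commute)
  show "- x - - perp S x \<in> span S"
    using span_neg[OF diff_perp_in_span[of x S]] by simp
qed

text \<open>
  The scales at the ends of the chain enter only through a distribution function followed by its
  inverse; in terms of the chain they are gone.
\<close>

lemma F_abc_scale_cong:
  assumes "a < b" "b < c" and "lam c \<le> t" "t \<le> lam a" and "a = 0 \<Longrightarrow> lam a = \<infinity>"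
    and "\<And>i. a \<le> i \<Longrightarrow> i \<le> c \<Longrightarrow> i \<noteq> 0 \<Longrightarrow> \<sigma> * \<rho> i > 0"
    and "\<And>i. a \<le> i \<Longrightarrow> i \<le> c \<Longrightarrow> i \<noteq> 0 \<Longrightarrow> \<sigma> * \<rho>' i > 0"
    and "\<And>i. a < i \<Longrightarrow> i < c \<Longrightarrow> \<rho> i = \<rho>' i"
  shows "F_abc \<sigma> \<rho> lam a b c t = F_abc \<sigma> \<rho>' lam a b c t"
proof -
  interpret S: scaled_chain \<sigma> \<rho> .
  interpret S': scaled_chain \<sigma> \<rho>' .
  have "S.G a c = S'.G a c" using assms by (intro PiM_cong) auto
  then show ?thesis
    using assms by (simp add: S.F_abc_eq_chain_measure S'.F_abc_eq_chain_measure)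
qed

context irrepresentable_tuple
begin

lemma w_nonzero: "i \<in> {1..length idx} \<Longrightarrow> w i \<noteq> 0"
  using w_nonzero_Suc[of "i - 1"] by (cases i) auto

lemma w_orthogonal: "i \<in> {1..length idx} \<Longrightarrow> k \<in> {1..length idx} \<Longrightarrow> i \<noteq> k \<Longrightarrow> w i \<bullet> w k = 0"
  using w_orthogonal_Suc[of "i - 1" "k - 1"] by (cases i; cases k) auto

lemma resid_inner_w: "i \<in> {1..length idx} \<Longrightarrow> resid (length idx) j \<bullet> w i = 0"
proof -
  assume i: "i \<in> {1..length idx}"
  have "w i \<in> span (signed_column X ` set (take i idx))"
    using w_in_span[of "i - 1"] i by (cases i) auto
  moreover have "set (take i idx) \<subseteq> set (take (length idx) idx)"
    using set_take_subset[of i idx] by simp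
  ultimately show ?thesis by (metis image_mono perp_inner_span span_mono subsetD)
qed

lemma resid_idx: "j \<in> set idx \<Longrightarrow> resid (length idx) j = 0"
  by (rule perp_unique) (auto intro: span_base)

text \<open>
  The component along each \<open>w i\<close> is overwritten such that the inner product with \<open>w i\<close> becomes \<open>s i\<close>.
\<close>

definition resample :: "nat \<Rightarrow> nat \<Rightarrow> real^'n \<Rightarrow> (nat \<Rightarrow> real) \<Rightarrow> real^'n" where
  "resample a c y s = y + (\<Sum>i\<in>{a<..<c}. ((s i - w i \<bullet> y) / (w i \<bullet> w i)) *\<^sub>R w i)"

lemma w_inner_resample:
  assumes c: "c \<le> Suc (length idx)" and k: "k \<in> {1..length idx}"
  shows "w k \<bullet> resample a c y s = (if a < k \<and> k < c then s k else w k \<bullet> y)"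
proof -
  have "w k \<bullet> resample a c y s = w k \<bullet> y + (\<Sum>i\<in>{a<..<c}. ((s i - w i \<bullet> y) / (w i \<bullet> w i)) * (w k \<bullet> w i))"
    by (simp add: resample_def inner_add_right inner_sum_right)
  also have "(\<Sum>i\<in>{a<..<c}. ((s i - w i \<bullet> y) / (w i \<bullet> w i)) * (w k \<bullet> w i)) =
      (\<Sum>i\<in>{a<..<c}. if i = k then s k - w k \<bullet> y else 0)"
  proof (rule sum.cong[OF refl])
    fix i assume "i \<in> {a<..<c}"
    then have "i \<in> {1..length idx}" using c by auto
    then show "((s i - w i \<bullet> y) / (w i \<bullet> w i)) * (w k \<bullet> w i) = (if i = k then s k - w k \<bullet> y else 0)"
      using w_orthogonal[of k i] w_nonzero[of k] k by auto
  qed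
  finally show ?thesis by (auto simp: sum.delta)
qed

lemma resid_inner_resample:
  assumes c: "c \<le> Suc (length idx)"
  shows "resid (length idx) j \<bullet> resample a c y s = resid (length idx) j \<bullet> y"
proof -
  have "(\<Sum>i\<in>{a<..<c}. ((s i - w i \<bullet> y) / (w i \<bullet> w i)) * (resid (length idx) j \<bullet> w i)) = 0"
  proof (rule sum.neutral, rule ballI)
    fix i assume "i \<in> {a<..<c}"
    then have "i \<in> {1..length idx}" using c by auto
    then show "((s i - w i \<bullet> y) / (w i \<bullet> w i)) * (resid (length idx) j \<bullet> w i) = 0"
      using resid_inner_w[of i j] by simp
  qed
  then show ?thesis by (simp add: resample_def inner_add_right inner_sum_right)
qed

text \<open>
  The knots up to \<open>length idx\<close> are inner products with the orthogonal directions. The last one depends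
  only on residuals, which are orthogonal to all directions.
\<close>

lemma tuple_knot_resample:
  assumes c: "c \<le> Suc (length idx)" and k: "k \<le> Suc (length idx)"
  shows "tuple_knot (resample a c y s) k = fill a c (tuple_knot y) s k"
proof -
  have "lars_ratio X (resample a c y s) idx = lars_ratio X y idx"
    using lars_ratio_eq[of "length idx"] resid_inner_resample[OF c] by (auto simp: fun_eq_iff)
  then show ?thesis
    using w_inner_resample[OF c, of k a y s] assms by (auto simp: tuple_knot_def fill_def)
qed

text \<open>
  This excludes the hyperplanes on which the last scale could vanish.
\<close>

definition generic :: "real^'n \<Rightarrow> bool" where
  "generic y \<longleftrightarrow> (\<forall>j. resid (length idx) j \<noteq> 0 \<longrightarrow> resid (length idx) j \<bullet> y \<noteq> 0)"

text \<open>
  Every excluded event is a hyperplane. Its normal vector is nonzero: for a tie, because by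
  orthogonality its inner product with \<open>w (Suc k)\<close> is.
\<close>

lemma AE_tie_free_generic: "AE \<eta> in noise_law \<sigma>. tie_free (m + \<eta>) \<and> generic (m + \<eta>)"
proof -
  have hyp: "AE \<eta> in noise_law \<sigma>. v \<bullet> (m + \<eta>) \<noteq> 0" if "v \<noteq> 0" for v :: "real^'n"
    using AE_noise_law_hyperplane[OF that, of "- (v \<bullet> m)" \<sigma>]
    by eventually_elim (simp add: inner_add_right)
  have 1: "AE \<eta> in noise_law \<sigma>. Suc k < length idx \<longrightarrow> w (Suc k) \<bullet> (m + \<eta>) \<noteq> w (Suc (Suc k)) \<bullet> (m + \<eta>)" for k
  proof (cases "Suc k < length idx")
    case True
    have "(w (Suc k) - w (Suc (Suc k))) \<bullet> w (Suc k) \<noteq> 0"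
      using True w_nonzero_Suc[of k] w_orthogonal_Suc[of "Suc k" k] by (simp add: inner_diff_left)
    then have "w (Suc k) - w (Suc (Suc k)) \<noteq> 0" by auto
    from hyp[OF this] show ?thesis by eventually_elim (simp add: inner_diff_left)
  qed simp
  have 2: "AE \<eta> in noise_law \<sigma>. length idx = Suc k \<longrightarrow> j \<notin> set idx \<longrightarrow>
      resid (length idx) j \<bullet> (m + \<eta>) \<noteq> slack (length idx) j * (w (Suc k) \<bullet> (m + \<eta>))" for k j
  proof (cases "length idx = Suc k \<and> j \<notin> set idx")
    case True
    have "(resid (length idx) j - slack (length idx) j *\<^sub>R w (Suc k)) \<bullet> w (Suc k) \<noteq> 0"
      using True w_nonzero_Suc[of k] resid_inner_w[of "Suc k" j] slack_pos[of "length idx" j]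
      by (simp add: inner_diff_left)
    then have "resid (length idx) j - slack (length idx) j *\<^sub>R w (Suc k) \<noteq> 0" by force
    from hyp[OF this] show ?thesis by eventually_elim (simp add: inner_diff_left)
  qed auto
  have 3: "AE \<eta> in noise_law \<sigma>. resid (length idx) j \<noteq> 0 \<longrightarrow> resid (length idx) j \<bullet> (m + \<eta>) \<noteq> 0" for j
    using hyp[of "resid (length idx) j"] by (cases "resid (length idx) j = 0") auto
  have "AE \<eta> in noise_law \<sigma>. \<forall>k. Suc k < length idx \<longrightarrow> w (Suc k) \<bullet> (m + \<eta>) \<noteq> w (Suc (Suc k)) \<bullet> (m + \<eta>)"
    using 1 by (subst AE_all_countable) blast
  moreover have "AE \<eta> in noise_law \<sigma>. \<forall>k j. length idx = Suc k \<longrightarrow> j \<notin> set idx \<longrightarrow>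
      resid (length idx) j \<bullet> (m + \<eta>) \<noteq> slack (length idx) j * (w (Suc k) \<bullet> (m + \<eta>))"
    using 2 by (subst AE_all_countable, intro allI, subst AE_all_countable) blast
  moreover have "AE \<eta> in noise_law \<sigma>. \<forall>j. resid (length idx) j \<noteq> 0 \<longrightarrow> resid (length idx) j \<bullet> (m + \<eta>) \<noteq> 0"
    using 3 by (subst AE_all_countable) blast
  ultimately show ?thesis
    by eventually_elim (simp add: tie_free_def generic_def)
qed

text \<open>
  Otherwise all columns lie in the span of \<open>length idx\<close> many.
\<close>

lemma resid_nonzero_exists:
  assumes "length idx < rank X" obtains j where "resid (length idx) j \<noteq> 0"
proof (rule ccontr)
  assume "\<not> thesis"
  then have 0: "resid (length idx) j = 0" for j using that by blast
  have "columns X \<subseteq> span (signed_column X ` set idx)"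
  proof
    fix v assume "v \<in> columns X"
    then obtain i where v: "v = column i X" by (auto simp: columns_def)
    have "signed_column X (Inl i) - resid (length idx) (Inl i) \<in> span (signed_column X ` set (take (length idx) idx))"
      by (rule diff_perp_in_span)
    then show "v \<in> span (signed_column X ` set idx)"
      using 0[of "Inl i"] v by (simp add: signed_column_def sign_of_def var_of_def)
  qed
  then have "rank X \<le> card (signed_column X ` set idx)"
    unfolding column_rank_def by (intro dim_le_card) auto
  also have "\<dots> \<le> card (set idx)" by (rule card_image_le) simp
  also have "\<dots> \<le> length idx" by (rule card_length)
  finally show False using assms by simp
qed

definition knots_descend :: "real^'n \<Rightarrow> bool" where
  "knots_descend y \<longleftrightarrow> descends 0 (Suc (length idx)) (tuple_knot y)"

lemma rho_take:
  assumes "k < length idx" shows "rho X (take (Suc k) idx) (Suc k) = norm (w (Suc k))"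
  unfolding norm_w[OF assms] by (simp add: rho_def min_def)

text \<open>
  For a column with nonzero residual, the two signs give opposite residuals, so one of the two signed
  variables has a positive ratio. Hence the maximal ratio is positive, and the variable attaining it has
  a nonzero residual.
\<close>

lemma last_rho_pos:
  assumes rank: "length idx < rank X" and kd: "knots_descend y" and gen: "generic y"
  shows "rho X (lars_path X y (Suc (length idx))) (Suc (length idx)) > 0"
proof -
  let ?K = "length idx"
  have path: "lars_path X y ?K = idx"
    using lars_path_of_descends[of y ?K] kd by (simp add: knots_descend_def)
  define h where "h = arg_max (lars_ratio X y idx) (\<lambda>j. theta X idx j < 1)"
  obtain j where j: "resid ?K j \<noteq> 0" using resid_nonzero_exists[OF rank] .
  \<comment> \<open>the same column with the opposite sign\<close>
  define j' where "j' = (case j of Inl v \<Rightarrow> Inr v | Inr v \<Rightarrow> Inl v)"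
  have "signed_column X j' = - signed_column X j"
    by (cases j) (simp_all add: j'_def signed_column_def sign_of_def var_of_def)
  then have j': "resid ?K j' = - resid ?K j" by (simp add: perp_minus)
  have "resid ?K j \<bullet> y \<noteq> 0" using gen j by (simp add: generic_def)
  moreover have "resid ?K j' \<bullet> y = - (resid ?K j \<bullet> y)" unfolding j' by (rule inner_minus_left)
  ultimately have "resid ?K j \<bullet> y > 0 \<or> resid ?K j' \<bullet> y > 0" by linarith
  then obtain i where i: "resid ?K i \<bullet> y > 0" by blast
  then have "i \<notin> set idx" using resid_idx[of i] by auto
  then have th: "theta X idx i < 1" using theta_less_1_set by auto
  have "0 < lars_ratio X y idx i"
    using i th lars_ratio_eq[of ?K y i] by simp
  also have "\<dots> \<le> lars_ratio X y idx h"
    unfolding h_def by (rule arg_max_finite(2)) (rule th)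
  finally have "resid ?K h \<noteq> 0" using lars_ratio_eq[of ?K y h] by auto
  moreover have "h \<notin> set idx"
    using arg_max_finite(1)[of "\<lambda>j. theta X idx j < 1", OF th] theta_less_1_set unfolding h_def by auto
  moreover have path_Suc: "lars_path X y (Suc ?K) = idx @ [h]" by (simp add: path h_def)
  ultimately show ?thesis
    unfolding path_Suc using rho_eq_norm[of ?K "idx @ [h]" h] slack_pos[of ?K h] by simp
qed

text \<open>
  At \<open>Suc (length idx)\<close> any positive value would serve, by \<open>F_abc_scale_cong\<close>.
\<close>

definition tuple_scale :: "nat \<Rightarrow> real" where
  "tuple_scale l = (if l \<le> length idx then norm (w l) else 1)"

lemma tuple_scale_pos: "i \<noteq> 0 \<Longrightarrow> tuple_scale i > 0"
  using w_nonzero[of i] by (simp add: tuple_scale_def)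

text \<open>
  The scales along the path are those of the tuple, except possibly at \<open>Suc (length idx)\<close>. There
  positivity is all that matters.
\<close>

lemma alpha_hat_eq:
  assumes "\<sigma> > 0" and rank: "length idx < rank X" and kd: "knots_descend y" and gen: "generic y"
    and abc: "a < b" "b < c" "c \<le> Suc (length idx)"
  shows "alpha_hat \<sigma> X y a b c =
    1 - F_abc \<sigma> tuple_scale (tuple_knot y) a b c (tuple_knot y b) /
      F_abc \<sigma> tuple_scale (tuple_knot y) a b c (tuple_knot y a)"
proof -
  let ?K = "length idx" and ?\<rho> = "\<lambda>l. rho X (lars_path X y l) l"
  have path: "lars_path X y k = take k idx" if "k \<le> ?K" for k
    using lars_path_of_descends that kd by (simp add: knots_descend_def)
  have knot: "lars_knot X y k = tuple_knot y k" if "k \<le> Suc ?K" for k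
    using lars_knot_of_path[of y k] path[of ?K] that by simp
  have \<rho>: "?\<rho> i = tuple_scale i" if "i \<in> {1..?K}" for i
  proof -
    obtain k where "i = Suc k" "k < ?K" using \<open>i \<in> {1..?K}\<close> by (cases i) auto
    then show ?thesis using path[of i] rho_take[of k] by (simp add: tuple_scale_def del: take_Suc)
  qed
  have \<rho>_pos: "\<sigma> * ?\<rho> i > 0" if "i \<le> c" "i \<noteq> 0" for i
  proof (cases "i \<le> ?K")
    case True
    then show ?thesis using \<rho>[of i] tuple_scale_pos[of i] that \<open>\<sigma> > 0\<close> by simp
  next
    case False
    then have "i = Suc ?K" using that abc by simp
    then show ?thesis using last_rho_pos[OF rank kd gen] \<open>\<sigma> > 0\<close> by simp
  qed
  have scale_pos: "\<sigma> * tuple_scale i > 0" if "i \<noteq> 0" for i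
    using tuple_scale_pos[OF that] \<open>\<sigma> > 0\<close> by simp
  have d: "descends 0 (Suc ?K) (tuple_knot y)" using kd by (simp add: knots_descend_def)
  then have dab: "descends a b (tuple_knot y)" and dbc: "descends b c (tuple_knot y)"
    using abc by (auto simp: descends_def)
  have lt: "tuple_knot y b < tuple_knot y a" "tuple_knot y c < tuple_knot y b"
    using descends_less[OF dab] descends_less[OF dbc] abc by auto
  have *: "F_abc \<sigma> ?\<rho> (lars_knot X y) a b c t = F_abc \<sigma> tuple_scale (tuple_knot y) a b c t"
    if "tuple_knot y c \<le> t" "t \<le> tuple_knot y a" for t
  proof -
    have "F_abc \<sigma> ?\<rho> (lars_knot X y) a b c t = F_abc \<sigma> ?\<rho> (tuple_knot y) a b c t"
      using abc knot by (intro F_abc_cong) auto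
    also have "\<dots> = F_abc \<sigma> tuple_scale (tuple_knot y) a b c t"
      using abc that \<rho> \<rho>_pos scale_pos
      by (intro F_abc_scale_cong) (auto simp: tuple_knot_def)
    finally show ?thesis .
  qed
  show ?thesis
    using *[of "tuple_knot y b"] *[of "tuple_knot y a"] lt less_trans[OF lt(2,1)] knot[of a] knot[of b] abc
    by (simp add: alpha_hat_def Let_def)
qed

end

context irrepresentable_tuple
begin

lemma borel_measurable_tuple_knot [measurable]: "(\<lambda>y. tuple_knot y k) \<in> borel_measurable borel"
  unfolding tuple_knot_def by measurable

lemma pred_generic [measurable]: "Measurable.pred borel generic"
  unfolding generic_def by measurable

lemma pred_knots_descend [measurable]: "Measurable.pred borel knots_descend"
  unfolding knots_descend_def by measurable

text \<open>
  For fixed \<open>y\<close>, the descent of the resampled knots splits into the descent outside of the window from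
  \<open>a\<close> to \<open>c\<close>, which concerns \<open>y\<close> alone, and the descent of the fresh values inside. On the latter,
  \<open>alpha_uniform_on_chain\<close> applies with the two end knots held fixed.
\<close>

lemma nn_integral_resampled_event:
  assumes "\<sigma> > 0" and rank: "length idx < rank X"
    and abc: "a < b" "b < c" "c \<le> Suc (length idx)"
    and Q: "\<And>s. Q (resample a c y s) \<longleftrightarrow> Q y" and B: "B \<in> sets borel"
  defines "\<mu> \<equiv> PiM {a<..<c} (\<lambda>i. gauss (\<sigma> * norm (w i)))"
  shows "(\<integral>\<^sup>+s. indicator {y. Q y \<and> generic y \<and> knots_descend y \<and> alpha_hat \<sigma> X y a b c \<in> B}
        (resample a c y s) \<partial>\<mu>) =
    (if Q y \<and> generic y \<and> descends 0 a (tuple_knot y) \<and> descends c (Suc (length idx)) (tuple_knot y)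
     then emeasure \<mu> {s \<in> space \<mu>. descends a c (fill a c (tuple_knot y) s)} else 0) * emeasure unif B"
proof -
  interpret S: scaled_chain \<sigma> tuple_scale .
  \<comment> \<open>inside the window the lengths of the directions are the scales of the tuple\<close>
  have \<mu>: "\<mu> = S.G a c"
    unfolding \<mu>_def using abc by (intro PiM_cong) (auto simp: tuple_scale_def)
  note [measurable] = B
  let ?k = "tuple_knot y" and ?K = "length idx"
  let ?F = "F_abc \<sigma> tuple_scale ?k a b c"
  let ?R = "\<lambda>s. descends a c (fill a c ?k s) \<and> 1 - ?F (ereal (s b)) / ?F (?k a) \<in> B"
  let ?C = "Q y \<and> generic y \<and> descends 0 a ?k \<and> descends c (Suc ?K) ?k"
  have b_comp [measurable]: "(\<lambda>s. s b) \<in> borel_measurable (S.G a c)"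
    using measurable_component_singleton[of b "{a<..<c}" "\<lambda>i. gauss (\<sigma> * tuple_scale i)"] abc
    by (simp cong: measurable_cong_sets)
  have event: "resample a c y s \<in> {y. Q y \<and> generic y \<and> knots_descend y \<and> alpha_hat \<sigma> X y a b c \<in> B} \<longleftrightarrow>
      ?C \<and> ?R s" for s
  proof -
    let ?y = "resample a c y s"
    have knot: "tuple_knot ?y k = fill a c ?k s k" if "k \<le> Suc ?K" for k
      using tuple_knot_resample abc that by simp
    have gen: "generic ?y \<longleftrightarrow> generic y"
      using resid_inner_resample abc by (simp add: generic_def)
    have "knots_descend ?y \<longleftrightarrow> descends 0 (Suc ?K) (fill a c ?k s)"
      unfolding knots_descend_def using knot by (intro descends_cong) auto
    also have "\<dots> \<longleftrightarrow> descends 0 a (fill a c ?k s) \<and> descends a c (fill a c ?k s) \<and>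
        descends c (Suc ?K) (fill a c ?k s)"
      using descends_split[of 0 a "Suc ?K"] descends_split[of a c "Suc ?K"] abc by auto
    also have "descends 0 a (fill a c ?k s) = descends 0 a ?k"
      by (intro descends_cong) (auto simp: fill_def)
    also have "descends c (Suc ?K) (fill a c ?k s) = descends c (Suc ?K) ?k"
      by (intro descends_cong) (auto simp: fill_def)
    finally have kd: "knots_descend ?y \<longleftrightarrow>
        descends 0 a ?k \<and> descends a c (fill a c ?k s) \<and> descends c (Suc ?K) ?k" .
    have knots: "tuple_knot ?y a = ?k a" "tuple_knot ?y c = ?k c" "tuple_knot ?y b = ereal (s b)"
      using knot abc by (auto simp: fill_def)
    have "alpha_hat \<sigma> X ?y a b c = 1 - ?F (ereal (s b)) / ?F (?k a)" if "knots_descend ?y" "generic ?y"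
    proof -
      have "F_abc \<sigma> tuple_scale (tuple_knot ?y) a b c t = ?F t" for t
        using abc knots by (intro F_abc_cong) auto
      then show ?thesis using alpha_hat_eq[OF \<open>\<sigma> > 0\<close> rank that abc] knots by simp
    qed
    then show ?thesis using Q[of s] gen kd by auto
  qed
  have meas: "{s \<in> space (S.G a c). ?R s} \<in> sets (S.G a c)" by measurable
  have "(\<integral>\<^sup>+s. indicator {y. Q y \<and> generic y \<and> knots_descend y \<and> alpha_hat \<sigma> X y a b c \<in> B}
      (resample a c y s) \<partial>\<mu>) = (\<integral>\<^sup>+s. (if ?C then 1 else 0) * indicator {s \<in> space (S.G a c). ?R s} s \<partial>S.G a c)"
    unfolding \<mu> by (intro nn_integral_cong) (use event in \<open>auto simp: indicator_def\<close>)
  also have "\<dots> = (if ?C then 1 else 0) * emeasure (S.G a c) {s \<in> space (S.G a c). ?R s}"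
    using meas by (subst nn_integral_cmult_indicator) auto
  also have "emeasure (S.G a c) {s \<in> space (S.G a c). ?R s} =
      emeasure (S.G a c) {s \<in> space (S.G a c). descends a c (fill a c ?k s)} * emeasure unif B"
    using abc B tuple_scale_pos \<open>\<sigma> > 0\<close> by (intro S.alpha_uniform_on_chain) (auto simp: tuple_knot_def)
  finally show ?thesis unfolding \<mu> by simp
qed

text \<open>
  The factor for \<open>B\<close> in \<open>nn_integral_resampled_event\<close> does not depend on \<open>y\<close> and comes out of the
  integral. What is left is the same integral with \<open>B = UNIV\<close>.
\<close>

lemma alpha_uniform_on_event:
  assumes "\<sigma> > 0" and rank: "length idx < rank X"
    and abc: "a < b" "b < c" "c \<le> Suc (length idx)"
    and m: "\<And>i. i \<in> {a<..<c} \<Longrightarrow> w i \<bullet> m = 0"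
    and Q [measurable]: "Measurable.pred borel Q" and Q_resample: "\<And>y s. Q (resample a c y s) \<longleftrightarrow> Q y"
    and B [measurable]: "B \<in> sets borel"
  shows "(\<integral>\<^sup>+\<eta>. indicator {y. Q y \<and> generic y \<and> knots_descend y \<and> alpha_hat \<sigma> X y a b c \<in> B} (m + \<eta>)
      \<partial>noise_law \<sigma>) =
    (\<integral>\<^sup>+\<eta>. indicator {y. Q y \<and> generic y \<and> knots_descend y} (m + \<eta>) \<partial>noise_law \<sigma>) * emeasure unif B"
proof -
  let ?\<mu> = "PiM {a<..<c} (\<lambda>i. gauss (\<sigma> * norm (w i)))"
  let ?ev = "\<lambda>B. {y. Q y \<and> generic y \<and> knots_descend y \<and> alpha_hat \<sigma> X y a b c \<in> B}"
  let ?h = "\<lambda>y. (if Q y \<and> generic y \<and> descends 0 a (tuple_knot y) \<and> descends c (Suc (length idx)) (tuple_knot y)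
     then emeasure ?\<mu> {s \<in> space ?\<mu>. descends a c (fill a c (tuple_knot y) s)} else 0)"
  note [measurable] = borel_measurable_alpha_hat[OF abc(1,2)]
  interpret \<mu>: prob_space ?\<mu> by (intro prob_space_PiM prob_space_gauss)
  have main: "(\<integral>\<^sup>+\<eta>. indicator (?ev B) (m + \<eta>) \<partial>noise_law \<sigma>) =
      (\<integral>\<^sup>+\<eta>. ?h (m + \<eta>) \<partial>noise_law \<sigma>) * emeasure unif B" if [measurable]: "B \<in> sets borel" for B
  proof -
    have ev [measurable]: "?ev B \<in> sets borel" by measurable
    have "(\<integral>\<^sup>+\<eta>. indicator (?ev B) (m + \<eta>) \<partial>noise_law \<sigma>) =
        (\<integral>\<^sup>+\<eta>. \<integral>\<^sup>+s. indicator (?ev B) (m + (\<eta> + (\<Sum>i\<in>{a<..<c}. ((s i - w i \<bullet> \<eta>) / (w i \<bullet> w i)) *\<^sub>R w i)))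
          \<partial>?\<mu> \<partial>noise_law \<sigma>)"
      using abc w_nonzero w_orthogonal \<open>\<sigma> > 0\<close>
      by (intro nn_integral_noise_law_resample[symmetric]) auto
    also have "\<dots> = (\<integral>\<^sup>+\<eta>. \<integral>\<^sup>+s. indicator (?ev B) (resample a c (m + \<eta>) s) \<partial>?\<mu> \<partial>noise_law \<sigma>)"
      using m by (simp add: resample_def inner_add_right add.assoc)
    also have "\<dots> = (\<integral>\<^sup>+\<eta>. ?h (m + \<eta>) * emeasure unif B \<partial>noise_law \<sigma>)"
      using nn_integral_resampled_event[OF \<open>\<sigma> > 0\<close> rank abc Q_resample that] by simp
    also have "\<dots> = (\<integral>\<^sup>+\<eta>. ?h (m + \<eta>) \<partial>noise_law \<sigma>) * emeasure unif B"
    proof (rule nn_integral_multc)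
      have D [measurable]: "Measurable.pred (borel \<Otimes>\<^sub>M ?\<mu>) (\<lambda>p. descends a c (fill a c (tuple_knot (m + fst p)) (snd p)))"
        by measurable
      have "emeasure ?\<mu> {s \<in> space ?\<mu>. descends a c (fill a c (tuple_knot (m + \<eta>)) s)} =
          (\<integral>\<^sup>+s. indicator {p. descends a c (fill a c (tuple_knot (m + fst p)) (snd p))} (\<eta>, s) \<partial>?\<mu>)" for \<eta>
        by (subst nn_integral_indicator[symmetric], measurable, intro nn_integral_cong) (simp add: indicator_def)
      then show "(\<lambda>\<eta>. ?h (m + \<eta>)) \<in> borel_measurable (noise_law \<sigma>)"
        by simp
    qed
    finally show ?thesis .
  qed
  have "(\<integral>\<^sup>+\<eta>. indicator (?ev UNIV) (m + \<eta>) \<partial>noise_law \<sigma>) = (\<integral>\<^sup>+\<eta>. ?h (m + \<eta>) \<partial>noise_law \<sigma>)"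
    using main[of UNIV] prob_space.emeasure_space_1[OF prob_space_unif] by simp
  then show ?thesis using main[OF B] by simp
qed

end


section \<open>The test statistic is uniform\<close>

theorem theorem2:
  fixes M :: "'w measure"
    and X :: "real^'p^'n"
    and \<beta>0 :: "real^'p"
    and \<eta> :: "'w \<Rightarrow> real^'n"
    and Y :: "'w \<Rightarrow> real^'n"
    and \<sigma> :: real
    and K a b c :: nat
    and mhat :: "'w \<Rightarrow> nat"
    and idx :: "('p + 'p) list"
    and E :: "'w set"
  assumes "prob_space M"
    and "rank X > 0"
    and "\<sigma> > 0"
    and "1 \<le> K" and "K < min CARD('n) (rank X)"
    and noise: "distributed M lborel \<eta> (\<lambda>x. ennreal (\<Prod>i\<in>UNIV. normal_density 0 \<sigma> (x $ i)))"
    and Y_def: "Y = (\<lambda>\<omega>. X *v \<beta>0 + \<eta> \<omega>)"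
    and "a < b" and "b < c" and "c \<le> K + 1"
    and "stopping_rule M K (\<lambda>\<omega>. lars_knot X (Y \<omega>)) (\<lambda>\<omega>. lars_index X (Y \<omega>)) mhat"
    and "idx \<in> index_tuples K"
    and "irrepresentable_check X idx"
    and E_def: "E = {\<omega> \<in> space M. mhat \<omega> \<le> a \<and>
                        (\<forall>k\<in>{1..K}. lars_index X (Y \<omega>) k = idx ! (k - 1))}"
    and "measure M E > 0"
    and null: "X *v \<beta>0 \<in> span ((\<lambda>i. column (var_of i) X) ` set (take a idx))"
  shows "(\<lambda>\<omega>. alpha_hat \<sigma> X (Y \<omega>) a b c) \<in> borel_measurable M \<and>
         distr (uniform_measure M E) borel (\<lambda>\<omega>. alpha_hat \<sigma> X (Y \<omega>) a b c) =
           uniform_measure lborel {0<..<1}"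
proof -
  interpret M: prob_space M by fact
  have K: "length idx = K" and "distinct idx"
    using \<open>idx \<in> index_tuples K\<close> by (auto simp: index_tuples_def distinct_map)
  then interpret irrepresentable_tuple X idx
    using \<open>irrepresentable_check X idx\<close> by unfold_locales
  have rank: "length idx < rank X" and abc: "a < b" "b < c" "c \<le> Suc (length idx)"
    using K assms by auto
  let ?m = "X *v \<beta>0" and ?\<alpha> = "\<lambda>y. alpha_hat \<sigma> X y a b c"
  have [measurable]: "?\<alpha> \<in> borel_measurable borel"
    using borel_measurable_alpha_hat abc by blast
  have [measurable]: "\<eta> \<in> borel_measurable M"
    using distributed_measurable[OF noise] by simp
  have [measurable]: "Y \<in> borel_measurable M" unfolding Y_def by measurable
  have law: "distr M borel \<eta> = noise_law \<sigma>"
  proof -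
    have "distr M borel \<eta> = distr M lborel \<eta>" by (rule distr_cong) simp_all
    then show ?thesis using distributed_distr_eq_density[OF noise] by (simp add: noise_law_def)
  qed
  have E: "E \<in> sets M"
    using \<open>measure M E > 0\<close> measure_notin_sets by fastforce
  \<comment> \<open>the null hypothesis: past \<open>a\<close>, the directions are orthogonal to the mean\<close>
  have m: "w i \<bullet> ?m = 0" if i: "i \<in> {a<..<c}" for i
  proof -
    obtain k where k: "i = Suc k" "a \<le> k" using i by (cases i) auto
    have "(\<lambda>i. column (var_of i) X) ` set (take a idx) \<subseteq> span (signed_column X ` set (take k idx))"
    proof clarify
      fix j assume "j \<in> set (take a idx)"
      then have "j \<in> set (take k idx)" using set_take_subset_set_take[OF k(2), of idx] by blast
      moreover have "column (var_of j) X = sign_of j *\<^sub>R signed_column X j"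
        by (cases j) (simp_all add: signed_column_def sign_of_def)
      ultimately show "column (var_of j) X \<in> span (signed_column X ` set (take k idx))"
        by (metis imageI span_base span_scale)
    qed
    then have "?m \<in> span (signed_column X ` set (take k idx))"
      using null span_minimal[OF _ subspace_span] by blast
    then show ?thesis unfolding k(1) by (rule w_inner_span)
  qed
  obtain g where g [measurable]: "g \<in> borel_measurable
        (PiM {1..a} (\<lambda>_. borel :: ereal measure) \<Otimes>\<^sub>M PiM {1..K} (\<lambda>_. count_space (UNIV :: ('p + 'p) set)))"
    and g_eq: "\<And>\<omega>. \<omega> \<in> space M \<Longrightarrow> (indicator {\<omega>' \<in> space M. mhat \<omega>' \<le> a} \<omega> :: real) =
      g (restrict (lars_knot X (Y \<omega>)) {1..a}, restrict (lars_index X (Y \<omega>)) {1..K})"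
  proof -
    have "a \<in> {0..K - 1}" using abc K by auto
    then show ?thesis using that \<open>stopping_rule M K _ _ mhat\<close> unfolding stopping_rule_def by blast
  qed
  \<comment> \<open>\<open>mhat \<le> a\<close> as a condition on the first \<open>a\<close> tuple knots, which resampling does not change\<close>
  define Q where "Q y \<longleftrightarrow> g (restrict (tuple_knot y) {1..a}, restrict (\<lambda>k. idx ! (k - 1)) {1..K}) = 1" for y
  have Q [measurable]: "Measurable.pred borel Q"
  proof -
    have [measurable]: "(\<lambda>y. restrict (tuple_knot y) {1..a}) \<in> measurable borel (PiM {1..a} (\<lambda>_. borel))"
      by (intro measurable_restrict borel_measurable_tuple_knot)
    have [measurable]: "(\<lambda>y::real^'n. restrict (\<lambda>k. idx ! (k - 1)) {1..K}) \<in>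
        measurable borel (PiM {1..K} (\<lambda>_. count_space UNIV))"
      by (intro measurable_restrict) simp
    show ?thesis unfolding Q_def by measurable
  qed
  have Q_resample: "Q (resample a c y s) \<longleftrightarrow> Q y" for y s
  proof -
    have "restrict (tuple_knot (resample a c y s)) {1..a} = restrict (tuple_knot y) {1..a}"
      using tuple_knot_resample[of c _ a y s] abc by (intro restrict_ext) (auto simp: fill_def)
    then show ?thesis by (simp add: Q_def)
  qed
  have E_iff: "\<omega> \<in> E \<longleftrightarrow> Q (Y \<omega>) \<and> lars_path X (Y \<omega>) (length idx) = idx" if \<omega>: "\<omega> \<in> space M" for \<omega>
  proof -
    have path_iff: "(\<forall>k\<in>{1..K}. lars_index X (Y \<omega>) k = idx ! (k - 1)) \<longleftrightarrow> lars_path X (Y \<omega>) (length idx) = idx"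
      using lars_index_eq_iff[of idx X "Y \<omega>"] K by simp
    have "mhat \<omega> \<le> a \<longleftrightarrow> Q (Y \<omega>)" if path: "lars_path X (Y \<omega>) (length idx) = idx"
    proof -
      have "restrict (lars_knot X (Y \<omega>)) {1..a} = restrict (tuple_knot (Y \<omega>)) {1..a}"
        using lars_knot_of_path[OF path] abc by (intro restrict_ext) auto
      moreover have "restrict (lars_index X (Y \<omega>)) {1..K} = restrict (\<lambda>k. idx ! (k - 1)) {1..K}"
        using path path_iff by (intro restrict_ext) auto
      ultimately show ?thesis
        using g_eq[OF \<omega>] \<omega> by (cases "mhat \<omega> \<le> a") (simp_all add: Q_def)
    qed
    then show ?thesis using \<omega> path_iff by (auto simp: E_def)
  qed
  have "AE \<omega> in M. tie_free (Y \<omega>) \<and> generic (Y \<omega>)"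
    unfolding Y_def
  proof (rule AE_distrD[of \<eta> M borel])
    show "AE x in distr M borel \<eta>. tie_free (?m + x) \<and> generic (?m + x)"
      unfolding law by (rule AE_tie_free_generic)
  qed simp
  then have E_AE: "AE \<omega> in M. \<omega> \<in> E \<longleftrightarrow> Q (Y \<omega>) \<and> generic (Y \<omega>) \<and> knots_descend (Y \<omega>)"
    using AE_space
  proof eventually_elim
    case (elim \<omega>)
    have "lars_path X (Y \<omega>) (length idx) = idx \<longleftrightarrow> knots_descend (Y \<omega>)"
      using descends_of_path[of "Y \<omega>"] lars_path_of_descends[of "Y \<omega>" "length idx"] elim
      by (auto simp: knots_descend_def)
    then show ?case using E_iff elim by blast
  qed
  have to_noise: "emeasure M {\<omega> \<in> E. ?\<alpha> (Y \<omega>) \<in> B} =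
      (\<integral>\<^sup>+x. indicator {y. Q y \<and> generic y \<and> knots_descend y \<and> ?\<alpha> y \<in> B} (?m + x) \<partial>noise_law \<sigma>)"
    if [measurable]: "B \<in> sets borel" for B
  proof -
    let ?ev = "{y. Q y \<and> generic y \<and> knots_descend y \<and> ?\<alpha> y \<in> B}"
    have ev [measurable]: "?ev \<in> sets borel" by measurable
    note [measurable] = E
    have EB: "{\<omega> \<in> E. ?\<alpha> (Y \<omega>) \<in> B} = {\<omega> \<in> space M. \<omega> \<in> E \<and> ?\<alpha> (Y \<omega>) \<in> B}"
      using sets.sets_into_space[OF E] by auto
    have "emeasure M {\<omega> \<in> E. ?\<alpha> (Y \<omega>) \<in> B} = (\<integral>\<^sup>+\<omega>. indicator {\<omega> \<in> E. ?\<alpha> (Y \<omega>) \<in> B} \<omega> \<partial>M)"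
      unfolding EB by (intro nn_integral_indicator[symmetric]) measurable
    also have "\<dots> = (\<integral>\<^sup>+\<omega>. indicator ?ev (?m + \<eta> \<omega>) \<partial>M)"
      by (rule nn_integral_cong_AE, use E_AE in eventually_elim) (auto simp: indicator_def Y_def)
    also have "\<dots> = (\<integral>\<^sup>+x. indicator ?ev (?m + x) \<partial>distr M borel \<eta>)"
      by (subst nn_integral_distr) auto
    finally show ?thesis unfolding law .
  qed
  have scale: "emeasure M {\<omega> \<in> E. ?\<alpha> (Y \<omega>) \<in> B} = emeasure M E * emeasure unif B"
    if B: "B \<in> sets borel" for B
    using to_noise[OF B] to_noise[of UNIV]
      alpha_uniform_on_event[OF \<open>\<sigma> > 0\<close> rank abc m Q Q_resample B]
    by simp
  have pos: "emeasure M E \<noteq> 0" using \<open>measure M E > 0\<close> by (auto simp: measure_def)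
  have "distr (uniform_measure M E) borel (\<lambda>\<omega>. ?\<alpha> (Y \<omega>)) = unif"
  proof (rule measure_eqI)
    fix B assume "B \<in> sets (distr (uniform_measure M E) borel (\<lambda>\<omega>. ?\<alpha> (Y \<omega>)))"
    then have B [measurable]: "B \<in> sets borel" by simp
    note [measurable] = E
    have "emeasure (distr (uniform_measure M E) borel (\<lambda>\<omega>. ?\<alpha> (Y \<omega>))) B =
        emeasure M (E \<inter> ((\<lambda>\<omega>. ?\<alpha> (Y \<omega>)) -` B \<inter> space M)) / emeasure M E"
      by (subst emeasure_distr) auto
    also have "E \<inter> ((\<lambda>\<omega>. ?\<alpha> (Y \<omega>)) -` B \<inter> space M) = {\<omega> \<in> E. ?\<alpha> (Y \<omega>) \<in> B}"
      using sets.sets_into_space[OF E] by auto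
    also have "emeasure M {\<omega> \<in> E. ?\<alpha> (Y \<omega>) \<in> B} / emeasure M E = emeasure unif B"
      unfolding scale[OF B] mult.commute[of "emeasure M E"]
      using pos by (intro mult_divide_eq_ennreal) auto
    finally show "emeasure (distr (uniform_measure M E) borel (\<lambda>\<omega>. ?\<alpha> (Y \<omega>))) B = emeasure unif B" .
  qed simp
  then show ?thesis by auto
qed

end
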